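(* Let $(M^n,g)$ be a Lie-Hermitian manifold of complex dimension $n$ with universal cover $(G,J,g)$, let $\mathfrak g$ be the Lie algebra of $G$, and let $\mathfrak g'=[\mathfrak g,\mathfrak g]$. Let $(\alpha,\beta)\in\mathbb R^2$ with $(\alpha,\beta)\neq(0,0)$. Assume that $\mathfrak g'+J\mathfrak g'$ is nilpotent. If the mixed curvature satisfies $\mathcal C_{\alpha,\beta}=c$ for some constant $c\in\mathbb R$, then $c=0$. If $\mathcal C_{\alpha,\beta}=0$ and $\beta\neq0$, then $g$ is Chern flat.
   Context: A Lie-Hermitian manifold is a compact quotient $M=G/\Gamma$ of an (even-dimensional real) Lie group $G$ by a discrete subgroup $\Gamma\subseteq G$, equipped with the complex structure and compatible Hermitian metric descending from a left-invariant complex structure $J$ and a left-invariant metric $g$ on $G$ compatible with $J$. The corresponding complex structure and inner product on $\mathfrak g$ are denoted by the same letters $J$ and $g$; here $J:\mathfrak g\to\mathfrak g$ is linear with $J^2=-I$, $[x,y]-[Jx,Jy]+J[Jx,y]+J[x,Jy]=0$ for all $x,y\in\mathfrak g$, and $\langle Jx,Jy\rangle=\langle x,y\rangle$. The subspace $\mathfrak g'+J\mathfrak g'$ contains $\mathfrak g'$, hence is an ideal of $\mathfrak g$; nilpotent means nilpotent as a Lie algebra. For a Hermitian manifold $(M^n,g)$, let $R$ be the curvature tensor of the Chern connection. For a nonzero $(1,0)$ tangent vector $X$, $H(X)=R(X,\overline X,X,\overline X)/|X|^4$ is the holomorphic sectional curvature, and $\operatorname{Ric}(X,\overline X)=\sum_{i=1}^n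 R(X,\overline X,e_i,\overline e_i)$ is the first Chern Ricci curvature, where $\{e_i\}$ is any local unitary frame of $(1,0)$ vectors (the last two arguments are the bundle, i.e. endomorphism, indices of the curvature). For real $\alpha,\beta$ the mixed curvature is $\mathcal C_{\alpha,\beta}(X)=\alpha\operatorname{Ric}(X,\overline X)+\beta H(X)$ for unit $(1,0)$ tangent vectors $X$. "$\mathcal C_{\alpha,\beta}=c$" means $\mathcal C_{\alpha,\beta}(X)=c$ for every unit $(1,0)$ tangent vector $X$ at every point. $g$ is Chern flat if $R=0$ identically. *)

theory Defs
  imports "HOL-Analysis.Analysis" "HOL-Algebra.Coset"
begin

section \<open>Smooth functions\<close>

text \<open>Only used for open subsets of Euclidean spaces.\<close>

primrec Ck_on :: "nat \<Rightarrow> 'a::real_normed_vector set \<Rightarrow> ('a \<Rightarrow> 'b::real_normed_vector) \<Rightarrow> bool" where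
  "Ck_on 0 S f \<longleftrightarrow> continuous_on S f"
| "Ck_on (Suc k) S f \<longleftrightarrow>
     f differentiable_on S \<and> (\<forall>v. Ck_on k S (\<lambda>x. frechet_derivative f (at x) v))"

definition smooth_on :: "'a::real_normed_vector set \<Rightarrow> ('a \<Rightarrow> 'b::real_normed_vector) \<Rightarrow> bool" where
  "smooth_on S f \<longleftrightarrow> (\<forall>k. Ck_on k S f)"

type_synonym ('g, 'a) chart = "'g set \<times> ('g \<Rightarrow> 'a)"

definition smooth_atlas :: "('g::topological_space, 'a::euclidean_space) chart set \<Rightarrow> bool" where
  "smooth_atlas A \<longleftrightarrow>
     (\<Union>(U, \<phi>)\<in>A. U) = UNIV \<and>
     (\<forall>(U, \<phi>)\<in>A. open U \<and> open (\<phi> ` U) \<and> homeomorphism U (\<phi> ` U) \<phi> (inv_into U \<phi>)) \<and>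
     (\<forall>(U, \<phi>)\<in>A. \<forall>(V, \<psi>)\<in>A. smooth_on (\<phi> ` (U \<inter> V)) (\<lambda>x. \<psi> (inv_into U \<phi> x)))"

definition smooth_fun ::
  "('g, 'a::euclidean_space) chart set \<Rightarrow> ('g \<Rightarrow> 'b::real_normed_vector) \<Rightarrow> bool" where
  "smooth_fun A f \<longleftrightarrow> (\<forall>(U, \<phi>)\<in>A. smooth_on (\<phi> ` U) (\<lambda>x. f (inv_into U \<phi> x)))"

text \<open>
  Smooth vector fields are the derivations of the algebra of smooth functions. The last
  clause fixes the irrelevant values on non-smooth arguments, so that equality of vector
  fields is equality of functions.
\<close>

definition vector_field ::
  "('g, 'a::euclidean_space) chart set \<Rightarrow> (('g \<Rightarrow> real) \<Rightarrow> 'g \<Rightarrow> real) \<Rightarrow> bool" where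
  "vector_field A Y \<longleftrightarrow>
     (\<forall>f. smooth_fun A f \<longrightarrow> smooth_fun A (Y f)) \<and>
     (\<forall>f h p. smooth_fun A f \<longrightarrow> smooth_fun A h \<longrightarrow>
        Y (\<lambda>x. f x + h x) p = Y f p + Y h p) \<and>
     (\<forall>r f p. smooth_fun A f \<longrightarrow> Y (\<lambda>x. r * f x) p = r * Y f p) \<and>
     (\<forall>f h p. smooth_fun A f \<longrightarrow> smooth_fun A h \<longrightarrow>
        Y (\<lambda>x. f x * h x) p = Y f p * h p + f p * Y h p) \<and>
     (\<forall>f. \<not> smooth_fun A f \<longrightarrow> Y f = (\<lambda>_. 0))"


section \<open>Lie groups and their Lie algebras\<close>

locale lie_group = group G
  for G :: "'g::{t2_space, second_countable_topology} monoid" (structure) +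
  fixes A :: "('g, 'a::euclidean_space) chart set"
  assumes carrier_UNIV: "carrier G = UNIV"
    and atlas: "smooth_atlas A"
    and continuous_mult: "continuous_on UNIV (\<lambda>(x, y). x \<otimes> y)"
    and continuous_inv: "continuous_on UNIV (m_inv G)"
    and smooth_mult:
      "\<lbrakk>(U, \<phi>) \<in> A; (V, \<psi>) \<in> A; (W, \<eta>) \<in> A\<rbrakk> \<Longrightarrow>
       smooth_on {(x, y). x \<in> \<phi> ` U \<and> y \<in> \<psi> ` V \<and> inv_into U \<phi> x \<otimes> inv_into V \<psi> y \<in> W}
                 (\<lambda>(x, y). \<eta> (inv_into U \<phi> x \<otimes> inv_into V \<psi> y))"
    and smooth_inv:
      "\<lbrakk>(U, \<phi>) \<in> A; (V, \<psi>) \<in> A\<rbrakk> \<Longrightarrow>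
       smooth_on {x. x \<in> \<phi> ` U \<and> m_inv G (inv_into U \<phi> x) \<in> V}
                 (\<lambda>x. \<psi> (m_inv G (inv_into U \<phi> x)))"
begin

definition left_invariant :: "(('g \<Rightarrow> real) \<Rightarrow> 'g \<Rightarrow> real) \<Rightarrow> bool" where
  "left_invariant Y \<longleftrightarrow>
     (\<forall>a f. smooth_fun A f \<longrightarrow> Y (\<lambda>x. f (a \<otimes> x)) = (\<lambda>x. Y f (a \<otimes> x)))"

end

text \<open>
  The Lie algebra of \<open>G\<close> is the space of left-invariant vector fields. The parameter \<open>E\<close>
  is a linear identification of it with the model space \<open>'a\<close>, and the bracket on \<open>'a\<close> is
  the commutator of vector fields transported along \<open>E\<close>. Evaluation of left-invariant
  vector fields identifies every tangent space of \<open>G\<close> with \<open>'a\<close>.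
\<close>

locale lie_group_algebra = lie_group G A
  for G :: "'g::{t2_space, second_countable_topology} monoid" (structure)
    and A :: "('g, 'a::euclidean_space) chart set" +
  fixes E :: "'a \<Rightarrow> ('g \<Rightarrow> real) \<Rightarrow> 'g \<Rightarrow> real"
  assumes bij_E: "bij_betw E UNIV {Y. vector_field A Y \<and> left_invariant Y}"
    and E_add: "E (u + v) f p = E u f p + E v f p"
    and E_scaleR: "E (r *\<^sub>R u) f p = r * E u f p"
begin

definition bracket :: "'a \<Rightarrow> 'a \<Rightarrow> 'a" where
  "bracket u v = the_inv E (\<lambda>f p. E u (E v f) p - E v (E u f) p)"

definition bracket_span :: "'a set \<Rightarrow> 'a set \<Rightarrow> 'a set" where
  "bracket_span S T = span {bracket x y | x y. x \<in> S \<and> y \<in> T}"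

definition derived_algebra :: "'a set" where
  "derived_algebra = bracket_span UNIV UNIV"

primrec lower_central :: "'a set \<Rightarrow> nat \<Rightarrow> 'a set" where
  "lower_central S 0 = S"
| "lower_central S (Suc k) = bracket_span S (lower_central S k)"

text \<open>For a Lie subalgebra \<open>S\<close>: nilpotency of \<open>S\<close> as a Lie algebra.\<close>

definition nilpotent_subalgebra :: "'a set \<Rightarrow> bool" where
  "nilpotent_subalgebra S \<longleftrightarrow> (\<exists>k. lower_central S k = {0})"

end


section \<open>Lie-Hermitian manifolds\<close>

text \<open>
  \<open>J\<close> is the complex structure on the Lie algebra; the left-invariant metric is the inner
  product of \<open>'a\<close>, that is, the identification \<open>E\<close> is chosen to be isometric. The discrete
  group \<open>\<Gamma>\<close> acts by left translations, which preserve all left-invariant tensors, so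
  the quotient manifold consists of the cosets \<open>\<Gamma> #> p\<close>.
\<close>

type_synonym ('g, 'a) covariant_derivative =
  "('g set \<Rightarrow> 'a) \<Rightarrow> ('g set \<Rightarrow> 'a) \<Rightarrow> 'g set \<Rightarrow> 'a"

definition quotient_topology :: "('g::topological_space \<Rightarrow> 'b) \<Rightarrow> 'b topology" where
  "quotient_topology q = topology (\<lambda>\<U>. \<U> \<subseteq> range q \<and> open (q -` \<U>))"

lemma quotient_map_quotient_topology: "quotient_map euclidean (quotient_topology q) q"
proof -
  have "istopology (\<lambda>\<U>. \<U> \<subseteq> range q \<and> open (q -` \<U>))"
    unfolding istopology_def by (auto simp: vimage_Union vimage_Int open_Int intro!: open_UN)
  then have op: "openin (quotient_topology q) \<U> \<longleftrightarrow> \<U> \<subseteq> range q \<and> open (q -` \<U>)" for \<U>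
    unfolding quotient_topology_def by (simp only: topology_inverse')
  have "q -` range q = UNIV" by auto
  then have "openin (quotient_topology q) (range q)"
    unfolding op by simp
  then have "topspace (quotient_topology q) = range q"
    using op[of "topspace (quotient_topology q)"] openin_subset by blast
  then show ?thesis
    unfolding quotient_map_def by (simp add: op vimage_def)
qed

locale lie_hermitian = lie_group_algebra G A E
  for G :: "'g::{t2_space, second_countable_topology} monoid" (structure)
    and A :: "('g, 'a::euclidean_space) chart set"
    and E :: "'a \<Rightarrow> ('g \<Rightarrow> real) \<Rightarrow> 'g \<Rightarrow> real" +
  fixes \<Gamma> :: "'g set" and J :: "'a \<Rightarrow> 'a"
  assumes subgroup_\<Gamma>: "subgroup \<Gamma> G"
    and discrete_\<Gamma>: "discrete \<Gamma>"
    and compact_quotient: "compact_space (quotient_topology (\<lambda>p. \<Gamma> #> p))"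
    and linear_J: "linear J"
    and J_J: "J (J x) = - x"
    and J_integrable:
      "bracket x y - bracket (J x) (J y) + J (bracket (J x) y) + J (bracket x (J y)) = 0"
    and J_isometry: "J x \<bullet> J y = x \<bullet> y"
begin

text \<open>The manifold \<open>M\<close>, its smooth functions, and the derivative along a vector field.
  By left translation the tangent bundle of \<open>M\<close> is \<open>M \<times> 'a\<close>, so a vector field on \<open>M\<close> is a
  function \<open>V\<close> from \<open>M\<close> to \<open>'a\<close>; it stands for \<open>m \<mapsto> E (V m)\<close> at \<open>m\<close>. In particular the constant
  fields are the left-invariant ones. Values outside \<open>M\<close> are irrelevant.\<close>

definition M :: "'g set set" where
  "M = rcosets \<Gamma>"

definition smoothM :: "('g set \<Rightarrow> 'b::real_normed_vector) \<Rightarrow> bool" where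
  "smoothM f \<longleftrightarrow> smooth_fun A (\<lambda>p. f (\<Gamma> #> p))"

definition deriv_along :: "('g set \<Rightarrow> 'a) \<Rightarrow> ('g set \<Rightarrow> real) \<Rightarrow> 'g set \<Rightarrow> real" where
  "deriv_along V f m = E (V m) (\<lambda>p. f (\<Gamma> #> p)) (SOME p. p \<in> m)"

lemma deriv_along_coset:
  assumes "smoothM f"
  shows "deriv_along V f (\<Gamma> #> p) = E (V (\<Gamma> #> p)) (\<lambda>q. f (\<Gamma> #> q)) p"
proof -
  have sub: "\<Gamma> \<subseteq> carrier G"
    by (simp add: carrier_UNIV)
  define q where "q = (SOME q. q \<in> \<Gamma> #> p)"
  have "p \<in> \<Gamma> #> p"
    using rcos_self[OF _ subgroup_\<Gamma>] by (simp add: carrier_UNIV)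
  then have "q \<in> \<Gamma> #> p"
    unfolding q_def by (rule someI)
  then obtain h where h: "h \<in> \<Gamma>" "q = h \<otimes> p"
    by (auto simp: r_coset_def)
  let ?f = "\<lambda>q. f (\<Gamma> #> q)"
  have inv: "?f (h \<otimes> x) = ?f x" for x
  proof -
    have "\<Gamma> #> (h \<otimes> x) = (\<Gamma> #> h) #> x"
      using coset_mult_assoc[OF sub, of h x] by (simp add: carrier_UNIV)
    also have "\<Gamma> #> h = \<Gamma>"
      using coset_join2[OF _ subgroup_\<Gamma> h(1)] by (simp add: carrier_UNIV)
    finally show ?thesis by simp
  qed
  have "left_invariant (E u)" for u
    using bij_E by (auto simp: bij_betw_def)
  then have "E u (\<lambda>x. ?f (h \<otimes> x)) = (\<lambda>x. E u ?f (h \<otimes> x))" for u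
    using assms unfolding left_invariant_def smoothM_def by blast
  then have "E u ?f (h \<otimes> p) = E u ?f p" for u
    using inv by (metis (no_types, lifting) ext)
  then show ?thesis
    unfolding deriv_along_def using h(2) q_def by metis
qed

text \<open>If \<open>V = \<Sum>\<^sub>a V\<^sub>a E\<^sub>a\<close> and \<open>W = \<Sum>\<^sub>b W\<^sub>b E\<^sub>b\<close> in a left-invariant frame, then
  \<open>[V, W] = \<Sum>\<^sub>b (V W\<^sub>b - W V\<^sub>b) E\<^sub>b + \<Sum>\<^sub>a\<^sub>b V\<^sub>a W\<^sub>b [E\<^sub>a, E\<^sub>b]\<close>.\<close>

definition field_bracket :: "('g set \<Rightarrow> 'a) \<Rightarrow> ('g set \<Rightarrow> 'a) \<Rightarrow> 'g set \<Rightarrow> 'a" where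
  "field_bracket V W m =
     (\<Sum>b\<in>Basis. (deriv_along V (\<lambda>m. W m \<bullet> b) m - deriv_along W (\<lambda>m. V m \<bullet> b) m) *\<^sub>R b)
     + bracket (V m) (W m)"

definition connection :: "('g, 'a) covariant_derivative \<Rightarrow> bool" where
  "connection D \<longleftrightarrow>
     (\<forall>V W. smoothM V \<longrightarrow> smoothM W \<longrightarrow> smoothM (D V W)) \<and>
     (\<forall>V V' W. smoothM V \<longrightarrow> smoothM V' \<longrightarrow> smoothM W \<longrightarrow>
        (\<forall>m\<in>M. D (\<lambda>m. V m + V' m) W m = D V W m + D V' W m)) \<and>
     (\<forall>f V W. smoothM f \<longrightarrow> smoothM V \<longrightarrow> smoothM W \<longrightarrow>
        (\<forall>m\<in>M. D (\<lambda>m. f m *\<^sub>R V m) W m = f m *\<^sub>R D V W m)) \<and>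
     (\<forall>V W W'. smoothM V \<longrightarrow> smoothM W \<longrightarrow> smoothM W' \<longrightarrow>
        (\<forall>m\<in>M. D V (\<lambda>m. W m + W' m) m = D V W m + D V W' m)) \<and>
     (\<forall>f V W. smoothM f \<longrightarrow> smoothM V \<longrightarrow> smoothM W \<longrightarrow>
        (\<forall>m\<in>M. D V (\<lambda>m. f m *\<^sub>R W m) m = deriv_along V f m *\<^sub>R W m + f m *\<^sub>R D V W m))"

definition torsion ::
  "('g, 'a) covariant_derivative \<Rightarrow> ('g set \<Rightarrow> 'a) \<Rightarrow> ('g set \<Rightarrow> 'a) \<Rightarrow> 'g set \<Rightarrow> 'a" where
  "torsion D V W m = D V W m - D W V m - field_bracket V W m"

text \<open>The Chern connection is the unique connection preserving metric and complex structure
  whose torsion \<open>T\<close> has no \<open>(1,1)\<close> part; for real arguments the latter says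
  \<open>T(JV, JW) = - T(V, W)\<close>.\<close>

definition chern_connection :: "('g, 'a) covariant_derivative \<Rightarrow> bool" where
  "chern_connection D \<longleftrightarrow>
     connection D \<and>
     (\<forall>U V W. smoothM U \<longrightarrow> smoothM V \<longrightarrow> smoothM W \<longrightarrow>
        (\<forall>m\<in>M. deriv_along U (\<lambda>m. V m \<bullet> W m) m = D U V m \<bullet> W m + V m \<bullet> D U W m)) \<and>
     (\<forall>V W. smoothM V \<longrightarrow> smoothM W \<longrightarrow>
        (\<forall>m\<in>M. D V (\<lambda>m. J (W m)) m = J (D V W m))) \<and>
     (\<forall>V W. smoothM V \<longrightarrow> smoothM W \<longrightarrow>
        (\<forall>m\<in>M. torsion D (\<lambda>m. J (V m)) (\<lambda>m. J (W m)) m = - torsion D V W m))"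

definition curvature ::
  "('g, 'a) covariant_derivative \<Rightarrow> ('g set \<Rightarrow> 'a) \<Rightarrow> ('g set \<Rightarrow> 'a) \<Rightarrow> ('g set \<Rightarrow> 'a)
     \<Rightarrow> 'g set \<Rightarrow> 'a" where
  "curvature D V W Z m = D V (D W Z) m - D W (D V Z) m - D (field_bracket V W) Z m"

text \<open>The curvature is tensorial, so its value on tangent vectors at \<open>m\<close> may be computed with
  any extension to vector fields; here the left-invariant one.\<close>

definition Rm ::
  "('g, 'a) covariant_derivative \<Rightarrow> 'g set \<Rightarrow> 'a \<Rightarrow> 'a \<Rightarrow> 'a \<Rightarrow> 'a \<Rightarrow> real" where
  "Rm D m x y z w = curvature D (\<lambda>_. x) (\<lambda>_. y) (\<lambda>_. z) m \<bullet> w"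

definition chern_flat :: "('g, 'a) covariant_derivative \<Rightarrow> bool" where
  "chern_flat D \<longleftrightarrow> (\<forall>m\<in>M. \<forall>x y z w. Rm D m x y z w = 0)"


subsection \<open>Complexified tangent vectors\<close>

text \<open>The pair \<open>(x, y)\<close> stands for the complex tangent vector \<open>x + \<i> y\<close>. Real multilinear
  forms are extended complex multilinearly, one argument at a time.\<close>

definition cext :: "('a \<Rightarrow> complex) \<Rightarrow> 'a \<times> 'a \<Rightarrow> complex" where
  "cext f X = f (fst X) + \<i> * f (snd X)"

definition conj_vec :: "'a \<times> 'a \<Rightarrow> 'a \<times> 'a" where
  "conj_vec X = (fst X, - snd X)"

text \<open>\<open>J X = \<i> X\<close>, as \<open>\<i> (x + \<i> y) = - y + \<i> x\<close>.\<close>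

definition type10 :: "'a \<times> 'a \<Rightarrow> bool" where
  "type10 X \<longleftrightarrow> (J (fst X), J (snd X)) = (- snd X, fst X)"

definition herm :: "'a \<times> 'a \<Rightarrow> 'a \<times> 'a \<Rightarrow> complex" where
  "herm X Y = cext (\<lambda>x. cext (\<lambda>y. complex_of_real (x \<bullet> y)) (conj_vec Y)) X"

definition RmC ::
  "('g, 'a) covariant_derivative \<Rightarrow> 'g set
     \<Rightarrow> 'a \<times> 'a \<Rightarrow> 'a \<times> 'a \<Rightarrow> 'a \<times> 'a \<Rightarrow> 'a \<times> 'a \<Rightarrow> complex" where
  "RmC D m X Y Z W =
     cext (\<lambda>x. cext (\<lambda>y. cext (\<lambda>z. cext (\<lambda>w. complex_of_real (Rm D m x y z w)) W) Z) Y) X"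

definition unitary_frame :: "('a \<times> 'a) set \<Rightarrow> bool" where
  "unitary_frame F \<longleftrightarrow>
     finite F \<and> 2 * card F = DIM('a) \<and> (\<forall>e\<in>F. type10 e) \<and>
     (\<forall>e\<in>F. \<forall>f\<in>F. herm e f = (if e = f then 1 else 0))"

text \<open>\<open>|X|\<^sup>4 = (herm X X)\<^sup>2\<close>.\<close>

definition hol_sect ::
  "('g, 'a) covariant_derivative \<Rightarrow> 'g set \<Rightarrow> 'a \<times> 'a \<Rightarrow> complex" where
  "hol_sect D m X = RmC D m X (conj_vec X) X (conj_vec X) / (herm X X)\<^sup>2"

text \<open>The sum does not depend on the choice of the unitary frame.\<close>

definition ric ::
  "('g, 'a) covariant_derivative \<Rightarrow> 'g set \<Rightarrow> 'a \<times> 'a \<Rightarrow> complex" where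
  "ric D m X =
     (\<Sum>e\<in>(SOME F. unitary_frame F). RmC D m X (conj_vec X) e (conj_vec e))"

definition mixed_curvature ::
  "('g, 'a) covariant_derivative \<Rightarrow> real \<Rightarrow> real \<Rightarrow> 'g set \<Rightarrow> 'a \<times> 'a \<Rightarrow> complex" where
  "mixed_curvature D \<alpha> \<beta> m X =
     complex_of_real \<alpha> * ric D m X + complex_of_real \<beta> * hol_sect D m X"

definition mixed_curvature_eq ::
  "('g, 'a) covariant_derivative \<Rightarrow> real \<Rightarrow> real \<Rightarrow> real \<Rightarrow> bool" where
  "mixed_curvature_eq D \<alpha> \<beta> c \<longleftrightarrow>
     (\<forall>m\<in>M. \<forall>X. type10 X \<and> herm X X = 1 \<longrightarrow>
        mixed_curvature D \<alpha> \<beta> m X = complex_of_real c)"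

end

end

theory Submission
  imports Defs
begin

text \<open>
  Put \<open>B x y = [x, y] + J[Jx, y]\<close>. This is the \<open>(0,1)\<close> part of the Chern connection on
  left-invariant fields, \<open>\<nabla>\<^sub>x = (B\<^sub>x - B\<^sub>x\<^sup>*)/2\<close>, and the sectional curvature becomes
  \<open>h(x) = (|B\<^sub>x\<^sup>*x|\<^sup>2 - |B\<^sub>xx|\<^sup>2)/2 - \<langle>B(B\<^sub>xx, x), x\<rangle>\<close>.

  If \<open>I = \<gg>' + J\<gg>'\<close> is nilpotent with lower central series \<open>C\<^sup>k\<close>, then \<open>B\<^sub>y\<close> maps
  \<open>C\<^sup>k + JC\<^sup>k\<close> to \<open>C\<^sup>k\<^sup>+\<^sup>1 + JC\<^sup>k\<^sup>+\<^sup>1\<close> for \<open>y \<in> I\<close>. As \<open>Ric(X, X)\<close> is a multiple of the trace of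
  \<open>JB\<^sub>y\<close> with \<open>y = [x, Jx] \<in> I\<close>, it vanishes, and the mixed curvature is \<open>\<beta>H\<close>.

  Suppose \<open>H\<close> is constant. Vectors orthogonal to the range of \<open>B\<close> exist by nilpotency and show \<open>H \<le> 0\<close>;
  vectors of \<open>K = {a \<in> I. B\<^sub>y a = 0 for y \<in> I}\<close> show \<open>H \<ge> 0\<close>. If \<open>H = 0\<close>, the part of
  \<open>h(a + y) = 0\<close> of second order in \<open>y\<close>, for \<open>a \<in> K\<close>, summed over orthonormal bases of \<open>\<gg>\<close> and \<open>K\<close>, shows
  that \<open>K\<close> is invariant under all \<open>B\<^sub>y\<^sup>*\<close>. Hence \<open>B(I, I)\<close> is orthogonal to \<open>K\<close>; but if nonzero it
  would meet \<open>K\<close>. It follows that \<open>B\<^sub>y = 0\<close> for \<open>y \<in> I\<close> and that the \<open>B\<^sub>x\<close> are commuting normal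
  operators, so the curvature vanishes.
\<close>

section \<open>Orthonormal sets and traces\<close>

definition orthonormal :: "'a::real_inner set \<Rightarrow> bool" where
  "orthonormal S \<longleftrightarrow> pairwise orthogonal S \<and> (\<forall>x\<in>S. norm x = 1)"

lemma orthonormal_inner:
  "orthonormal S \<Longrightarrow> x \<in> S \<Longrightarrow> y \<in> S \<Longrightarrow> x \<bullet> y = (if x = y then 1 else 0)"
  by (auto simp: orthonormal_def pairwise_def orthogonal_def norm_eq_1)

lemma orthonormalI:
  assumes "\<And>x y. x \<in> S \<Longrightarrow> y \<in> S \<Longrightarrow> x \<bullet> y = (if x = y then 1 else 0)"
  shows "orthonormal S"
  using assms by (auto simp: orthonormal_def pairwise_def orthogonal_def norm_eq_1)

lemma orthonormal_independent:
  "orthonormal S \<Longrightarrow> independent S"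
  by (rule pairwise_orthogonal_independent) (auto simp: orthonormal_def)

lemma orthonormal_basis_exists:
  fixes S :: "'a::euclidean_space set"
  assumes "subspace S"
  obtains X where "finite X" "orthonormal X" "span X = S"
  using orthonormal_basis_subspace[OF assms] independent_imp_finite
  unfolding orthonormal_def by metis

lemma parseval:
  assumes "finite X" "orthonormal X" "x \<in> span X"
  shows "x \<bullet> y = (\<Sum>b\<in>X. (x \<bullet> b) * (y \<bullet> b))"
  using assms(3)
proof (induction rule: span_induct)
  case base
  show ?case
    by (auto simp: subspace_def inner_add_left distrib_right sum.distrib sum_distrib_left mult.assoc)
next
  case (step x)
  have "(\<Sum>b\<in>X. (x \<bullet> b) * (y \<bullet> b)) = (\<Sum>b\<in>X. if x = b then y \<bullet> b else 0)"
    using step by (intro sum.cong) (simp_all add: orthonormal_inner[OF assms(2)])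
  then show ?case
    using step assms(1) by (simp add: inner_commute)
qed

lemma parseval_norm:
  assumes "finite X" "orthonormal X" "x \<in> span X"
  shows "(norm x)\<^sup>2 = (\<Sum>b\<in>X. (x \<bullet> b)\<^sup>2)"
  using parseval[OF assms, of x] unfolding power2_norm_eq_inner by (simp add: power2_eq_square)

text \<open>The sum is the orthogonal projection of \<open>x\<close> to the span of
  \<open>X\<close>, so this is Pythagoras.\<close>

lemma bessel_defect:
  assumes "finite X" "orthonormal X"
  shows "(norm (x - (\<Sum>b\<in>X. (x \<bullet> b) *\<^sub>R b)))\<^sup>2 = (norm x)\<^sup>2 - (\<Sum>b\<in>X. (x \<bullet> b)\<^sup>2)"
proof -
  let ?p = "\<Sum>b\<in>X. (x \<bullet> b) *\<^sub>R b"
  have p: "?p \<in> span X"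
    by (intro span_sum span_mul span_base)
  have pb: "?p \<bullet> b = x \<bullet> b" if "b \<in> X" for b
  proof -
    have "?p \<bullet> b = (\<Sum>c\<in>X. if c = b then x \<bullet> c else 0)"
      unfolding inner_sum_left
      using that by (intro sum.cong) (simp_all add: orthonormal_inner[OF assms(2)])
    then show ?thesis using that assms(1) by simp
  qed
  have "?p \<bullet> ?p = (\<Sum>b\<in>X. (x \<bullet> b)\<^sup>2)" "?p \<bullet> x = (\<Sum>b\<in>X. (x \<bullet> b)\<^sup>2)"
    using parseval[OF assms p] pb by (simp_all add: power2_eq_square)
  then show ?thesis
    by (simp add: power2_norm_eq_inner inner_diff_left inner_diff_right inner_commute)
qed

lemma bessel:
  assumes "finite X" "orthonormal X"
  shows "(\<Sum>b\<in>X. (x \<bullet> b)\<^sup>2) \<le> (norm x)\<^sup>2"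
  using bessel_defect[OF assms, of x] zero_le_power2 by (metis diff_ge_0_iff_ge)

lemma bessel_eq_imp_span:
  assumes "finite X" "orthonormal X" "(norm x)\<^sup>2 = (\<Sum>b\<in>X. (x \<bullet> b)\<^sup>2)"
  shows "x \<in> span X"
proof -
  have "x = (\<Sum>b\<in>X. (x \<bullet> b) *\<^sub>R b)"
    using bessel_defect[OF assms(1,2), of x] assms(3) by simp
  moreover have "(\<Sum>b\<in>X. (x \<bullet> b) *\<^sub>R b) \<in> span X"
    by (intro span_sum span_mul span_base)
  ultimately show ?thesis by simp
qed

definition tr :: "('a::euclidean_space \<Rightarrow> 'a) \<Rightarrow> real" where
  "tr f = (\<Sum>b\<in>Basis. f b \<bullet> b)"

lemma tr_orthonormal:
  fixes f :: "'a::euclidean_space \<Rightarrow> 'a"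
  assumes "finite X" "orthonormal X" "span X = UNIV" "linear f"
  shows "tr f = (\<Sum>x\<in>X. f x \<bullet> x)"
proof -
  have "(\<Sum>x\<in>X. f x \<bullet> x) = (\<Sum>x\<in>X. \<Sum>b\<in>Basis. (x \<bullet> b) * (f b \<bullet> x))"
  proof (intro sum.cong refl)
    fix x
    have "f x = f (\<Sum>b\<in>Basis. (x \<bullet> b) *\<^sub>R b)" by (simp add: euclidean_representation)
    also have "\<dots> = (\<Sum>b\<in>Basis. (x \<bullet> b) *\<^sub>R f b)"
      using assms(4) by (simp add: linear_sum linear_scale)
    finally show "f x \<bullet> x = (\<Sum>b\<in>Basis. (x \<bullet> b) * (f b \<bullet> x))"
      by (simp add: inner_sum_left)
  qed
  also have "\<dots> = (\<Sum>b\<in>Basis. \<Sum>x\<in>X. (b \<bullet> x) * (f b \<bullet> x))"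
    by (subst sum.swap) (simp add: inner_commute)
  also have "\<dots> = (\<Sum>b\<in>Basis. b \<bullet> f b)"
    using assms by (simp add: parseval[symmetric])
  finally show ?thesis by (simp add: tr_def inner_commute)
qed

lemma tr_add: "tr (\<lambda>x. f x + g x) = tr f + tr g"
  by (simp add: tr_def inner_add_left sum.distrib)

lemma tr_diff: "tr (\<lambda>x. f x - g x) = tr f - tr g"
  by (simp add: tr_def inner_diff_left sum_subtractf)

lemma tr_scaleR: "tr (\<lambda>x. c *\<^sub>R f x) = c * tr f"
  by (simp add: tr_def sum_distrib_left)

text \<open>Expanded in the standard basis, both sides are the sum of the matrix entries of
  \<open>f\<close> times the values \<open>h b c\<close>. With the inner product in \<open>h\<close>
  this gives cyclicity of the trace; \<open>h = B\<close> is used in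
  \<open>sum_norm_Bt_K\<close>.\<close>

lemma sum_bilinear_adjoint:
  fixes f :: "'a::euclidean_space \<Rightarrow> 'a" and h :: "'a \<Rightarrow> 'a \<Rightarrow> 'b::real_vector"
  assumes "linear f" "bilinear h"
  shows "(\<Sum>b\<in>Basis. h b (adjoint f b)) = (\<Sum>b\<in>Basis. h (f b) b)"
proof -
  have "(\<Sum>b\<in>Basis. h b (adjoint f b)) =
      (\<Sum>b\<in>Basis. h b (\<Sum>c\<in>Basis. (adjoint f b \<bullet> c) *\<^sub>R c))"
    by (simp add: euclidean_representation)
  also have "\<dots> = (\<Sum>b\<in>Basis. \<Sum>c\<in>Basis. (b \<bullet> f c) *\<^sub>R h b c)"
    using assms by (simp add: bilinear_def linear_sum linear_scale adjoint_clauses)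
  also have "\<dots> = (\<Sum>c\<in>Basis. h (\<Sum>b\<in>Basis. (f c \<bullet> b) *\<^sub>R b) c)"
  proof -
    interpret l: linear "\<lambda>x. h x c" for c using assms by (simp add: bilinear_def)
    show ?thesis
      by (subst sum.swap) (simp only: l.sum l.scale inner_commute)
  qed
  finally show ?thesis by (simp add: euclidean_representation)
qed

lemma tr_comp_commute:
  fixes f g :: "'a::euclidean_space \<Rightarrow> 'a"
  assumes "linear f" "linear g"
  shows "tr (\<lambda>x. f (g x)) = tr (\<lambda>x. g (f x))"
proof -
  have "bilinear (\<lambda>x y. f x \<bullet> y)"
    using assms(1) by (auto simp: bilinear_def linear_iff inner_add_left inner_add_right)
  from sum_bilinear_adjoint[OF assms(2) this] show ?thesis
    using assms(2) by (simp add: tr_def adjoint_works)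
qed

lemma tr_adjoint:
  fixes f :: "'a::euclidean_space \<Rightarrow> 'a"
  assumes "linear f"
  shows "tr (adjoint f) = tr f"
  using assms by (simp add: tr_def adjoint_clauses inner_commute)

lemma sum_norm_adjoint:
  fixes f :: "'a::euclidean_space \<Rightarrow> 'a"
  assumes "linear f"
  shows "(\<Sum>b\<in>Basis. (norm (adjoint f b))\<^sup>2) = (\<Sum>b\<in>Basis. (norm (f b))\<^sup>2)"
proof -
  have "tr (\<lambda>x. f (adjoint f x)) = tr (\<lambda>x. adjoint f (f x))"
    by (rule tr_comp_commute[OF assms adjoint_linear[OF assms]])
  then show ?thesis
    using assms by (simp add: tr_def power2_norm_eq_inner adjoint_clauses inner_commute)
qed

text \<open>Induction on the nilpotency index: a basis of the image of \<open>S\<close> is completed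
  by an orthonormal basis of the orthogonal complement of that image in \<open>S\<close>. A new
  vector \<open>y\<close> is orthogonal to the image, hence to \<open>f y\<close>.\<close>

lemma nilpotent_adapted_basis:
  fixes f :: "'a::euclidean_space \<Rightarrow> 'a"
  assumes "linear f" "subspace S" "f ` S \<subseteq> S" "\<And>x. x \<in> S \<Longrightarrow> (f ^^ m) x = 0"
  shows "\<exists>X. finite X \<and> orthonormal X \<and> span X = S \<and> (\<forall>x\<in>X. f x \<bullet> x = 0)"
  using assms(2-)
proof (induction m arbitrary: S)
  case 0
  then have "S = {0}" using subspace_0 by fastforce
  then show ?case
    by (intro exI[of _ "{}"]) (simp add: orthonormal_def)
next
  case (Suc m)
  let ?T = "f ` S"
  have T: "subspace ?T" using assms(1) Suc.prems(1) by (rule linear_subspace_image)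
  have "(f ^^ m) y = 0" if "y \<in> ?T" for y
    using that Suc.prems(3) by (auto simp: funpow_swap1)
  then obtain X where X: "finite X" "orthonormal X" "span X = ?T" "\<forall>x\<in>X. f x \<bullet> x = 0"
    using Suc.IH[OF T] Suc.prems(2) by blast
  have "subspace {x \<in> S. \<forall>y\<in>?T. x \<bullet> y = 0}"
    using Suc.prems(1) by (auto simp: subspace_def inner_add_left)
  from orthonormal_basis_exists[OF this]
  obtain Y where Y: "finite Y" "orthonormal Y" "span Y = {x \<in> S. \<forall>y\<in>?T. x \<bullet> y = 0}" .
  have XT: "x \<in> ?T" if "x \<in> X" for x using span_base[OF that] X(3) by simp
  have YS: "y \<in> S" "z \<in> ?T \<Longrightarrow> y \<bullet> z = 0" if "y \<in> Y" for y z
    using span_base[OF that] unfolding Y(3) by auto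
  have "orthonormal (X \<union> Y)"
  proof (rule orthonormalI)
    fix x y assume xy: "x \<in> X \<union> Y" "y \<in> X \<union> Y"
    have 0: "v \<bullet> w = 0" "w \<bullet> v = 0" if "v \<in> Y" "w \<in> X" for v w
      using YS(2)[OF that(1) XT[OF that(2)]] by (simp_all add: inner_commute)
    have "v \<noteq> w" if "v \<in> Y" "w \<in> X" for v w
      using 0[OF that] orthonormal_inner[OF Y(2) that(1) that(1)] by auto
    then show "x \<bullet> y = (if x = y then 1 else 0)"
      using xy 0 orthonormal_inner[OF X(2), of x y] orthonormal_inner[OF Y(2), of x y] by auto
  qed
  moreover have "span (X \<union> Y) = S"
  proof
    show "span (X \<union> Y) \<subseteq> S"
      using XT YS(1) Suc.prems(1,2) by (intro span_minimal) auto
    show "S \<subseteq> span (X \<union> Y)"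
    proof
      fix x assume "x \<in> S"
      obtain y z where yz: "y \<in> span ?T" "\<And>w. w \<in> span ?T \<Longrightarrow> orthogonal z w" "x = y + z"
        using orthogonal_subspace_decomp_exists[of ?T x] by metis
      have "span ?T = ?T" using T by (simp only: span_eq_iff)
      with yz(1) have "y \<in> ?T" by metis
      then have "y \<in> span X" "y \<in> S" using X(3) Suc.prems(2) by auto
      moreover have "z \<in> S"
        using subspace_diff[OF Suc.prems(1) \<open>x \<in> S\<close> \<open>y \<in> S\<close>] yz(3) by simp
      then have "z \<in> span Y"
        unfolding Y(3) using yz(2)[OF span_base] by (simp add: orthogonal_def)
      ultimately show "x \<in> span (X \<union> Y)"
        unfolding yz(3) using span_mono[of X "X \<union> Y"] span_mono[of Y "X \<union> Y"]
        by (intro span_add) auto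
    qed
  qed
  moreover have "f y \<bullet> y = 0" if "y \<in> Y" for y
    using YS(2)[OF that, of "f y"] YS(1)[OF that] by (simp add: inner_commute)
  ultimately show ?case
    using X(1,4) Y(1) by (intro exI[of _ "X \<union> Y"]) auto
qed

lemma tr_nilpotent:
  fixes f :: "'a::euclidean_space \<Rightarrow> 'a"
  assumes "linear f" "\<And>x. (f ^^ m) x = 0"
  shows "tr f = 0"
proof -
  obtain X where "finite X" "orthonormal X" "span X = UNIV" "\<forall>x\<in>X. f x \<bullet> x = 0"
    using nilpotent_adapted_basis[OF assms(1), of UNIV m] assms(2) by auto
  then show ?thesis using tr_orthonormal[of X f] assms(1) by simp
qed

section \<open>Hermitian Lie algebras\<close>

locale hermitian_lie_algebra =
  fixes br :: "'a::euclidean_space \<Rightarrow> 'a \<Rightarrow> 'a" and J :: "'a \<Rightarrow> 'a"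
  assumes bilinear_br: "bilinear br"
    and br_skew: "br x y = - br y x"
    and jacobi: "br x (br y z) = br (br x y) z + br y (br x z)"
    and linear_J: "linear J"
    and J_J: "J (J x) = - x"
    and J_integrable: "br x y - br (J x) (J y) + J (br (J x) y) + J (br x (J y)) = 0"
    and J_isometry: "J x \<bullet> J y = x \<bullet> y"
begin

lemma J_simps:
  "J (x + y) = J x + J y" "J (x - y) = J x - J y" "J (- x) = - J x" "J (c *\<^sub>R x) = c *\<^sub>R J x" "J 0 = 0"
  using linear_J by (simp_all add: linear_add linear_diff linear_neg linear_scale linear_0)

lemma br_simps:
  "br (x + y) z = br x z + br y z" "br x (y + z) = br x y + br x z"
  "br (x - y) z = br x z - br y z" "br x (y - z) = br x y - br x z"
  "br (- x) y = - br x y" "br x (- y) = - br x y"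
  "br (c *\<^sub>R x) y = c *\<^sub>R br x y" "br x (c *\<^sub>R y) = c *\<^sub>R br x y"
  using bilinear_br by (simp_all add: bilinear_ladd bilinear_radd bilinear_lsub bilinear_rsub
      bilinear_lneg bilinear_rneg bilinear_lmul bilinear_rmul)

lemma br_self: "br x x = 0"
proof -
  have "2 *\<^sub>R br x x = 0"
    using br_skew[of x x] unfolding scaleR_2 by (metis add.right_inverse)
  then show ?thesis by simp
qed

lemma J_inner_left: "J x \<bullet> y = - (x \<bullet> J y)"
  using J_isometry[of x "J y"] by (simp add: J_J)

lemma J_inner_self [simp]: "J x \<bullet> x = 0" "x \<bullet> J x = 0"
  using J_inner_left[of x x] by (simp_all add: inner_commute)

lemma norm_J [simp]: "norm (J x) = norm x"
  using J_isometry by (simp add: norm_eq_sqrt_inner)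

lemma br_J_J: "br (J x) (J y) = br x y + J (br (J x) y) + J (br x (J y))"
  using J_integrable[of x y] by (simp add: algebra_simps)

section \<open>The operators \<open>B x\<close>\<close>

text \<open>On complexified vectors, \<open>B x y\<close> is the \<open>(1,0)\<close> part of \<open>[x + \<i>Jx, y]\<close>: it is the
  \<open>(0,1)\<close> part of the Chern connection, antilinear in \<open>x\<close> and complex linear in \<open>y\<close>.\<close>

definition B :: "'a \<Rightarrow> 'a \<Rightarrow> 'a" where
  "B x y = br x y + J (br (J x) y)"

lemma bilinear_B: "bilinear B"
  unfolding bilinear_def by (intro conjI allI linearI)
    (simp_all add: B_def br_simps J_simps algebra_simps)

lemma linear_B: "linear (B x)"
  using bilinear_B by (simp add: bilinear_def)

lemma B_simps:
  "B (x + y) z = B x z + B y z" "B x (y + z) = B x y + B x z"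
  "B (x - y) z = B x z - B y z" "B x (y - z) = B x y - B x z"
  "B (- x) y = - B x y" "B x (- y) = - B x y"
  "B (c *\<^sub>R x) y = c *\<^sub>R B x y" "B x (c *\<^sub>R y) = c *\<^sub>R B x y"
  "B 0 y = 0" "B x 0 = 0"
  using bilinear_B by (simp_all add: bilinear_ladd bilinear_radd bilinear_lsub bilinear_rsub
      bilinear_lneg bilinear_rneg bilinear_lmul bilinear_rmul bilinear_lzero bilinear_rzero)

lemma B_J_left: "B (J x) y = - J (B x y)"
  by (simp add: B_def J_J J_simps br_simps)

lemma B_J_right: "B x (J y) = J (B x y)"
  by (simp add: B_def J_J J_simps br_J_J)

text \<open>\<open>B\<close> is the action of the subalgebra of \<open>(0,1)\<close> vectors on the quotient by it.\<close>

lemma B_commutator: "B x (B y z) - B y (B x z) = B (br x y - br (J x) (J y)) z"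
proof -
  have e: "B u (B v z) = br u (br v z) + J (br (J u) (br v z))
      + J (br u (br (J v) z)) - br (J u) (br (J v) z)" for u v
  proof -
    have "B u (B v z) = B u (br v z) + J (B u (br (J v) z))"
      by (subst (2) B_def) (simp add: B_simps B_J_right)
    then show ?thesis by (simp add: B_def J_simps J_J)
  qed
  \<comment> \<open>Integrability: the bracket of the (0,1) vectors x + iJx and y + iJy is again of
    the form u + iJu, with \<open>u = br x y - br (J x) (J y)\<close>.\<close>
  have j: "J (br x y - br (J x) (J y)) = br (J x) y + br x (J y)"
    by (simp add: br_J_J J_simps J_J)
  have "B (br x y - br (J x) (J y)) z
      = br (br x y) z - br (br (J x) (J y)) z + J (br (br (J x) y) z) + J (br (br x (J y)) z)"
    unfolding B_def j by (simp add: br_simps J_simps)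
  then show ?thesis
    unfolding e jacobi[of x y] jacobi[of "J x" y] jacobi[of x "J y"] jacobi[of "J x" "J y"]
    by (simp add: J_simps)
qed

section \<open>Adjoints and the Chern connection on left-invariant fields\<close>

definition Bt :: "'a \<Rightarrow> 'a \<Rightarrow> 'a" where
  "Bt x = adjoint (B x)"

lemma Bt_inner: "x \<bullet> Bt u y = B u x \<bullet> y" "Bt u y \<bullet> x = y \<bullet> B u x"
  by (simp_all add: Bt_def adjoint_clauses[OF linear_B])

lemma Bt_eqI: "(\<And>z. B u z \<bullet> y = z \<bullet> w) \<Longrightarrow> Bt u y = w"
  by (subst vector_eq_rdot[symmetric]) (simp add: Bt_inner inner_commute)

lemma bilinear_Bt: "bilinear Bt"
  unfolding bilinear_def
  by (intro conjI allI linearI; rule Bt_eqI)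
    (simp_all add: B_simps inner_add_left inner_add_right Bt_inner)

lemma Bt_simps:
  "Bt (x + y) z = Bt x z + Bt y z" "Bt x (y + z) = Bt x y + Bt x z"
  "Bt (x - y) z = Bt x z - Bt y z" "Bt x (y - z) = Bt x y - Bt x z"
  "Bt (- x) y = - Bt x y" "Bt x (- y) = - Bt x y"
  "Bt (c *\<^sub>R x) y = c *\<^sub>R Bt x y" "Bt x (c *\<^sub>R y) = c *\<^sub>R Bt x y"
  "Bt 0 y = 0" "Bt x 0 = 0"
  using bilinear_Bt by (simp_all add: bilinear_ladd bilinear_radd bilinear_lsub bilinear_rsub
      bilinear_lneg bilinear_rneg bilinear_lmul bilinear_rmul bilinear_lzero bilinear_rzero)

lemma Bt_J_right: "Bt x (J y) = J (Bt x y)"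
proof (rule Bt_eqI)
  fix z
  show "B x z \<bullet> J y = z \<bullet> J (Bt x y)"
    using J_inner_left[of "B x z" y] J_inner_left[of z "Bt x y"] Bt_inner(1)[of "J z" x y]
    by (simp add: B_J_right)
qed

lemma Bt_J_left: "Bt (J x) y = J (Bt x y)"
proof (rule Bt_eqI)
  fix z
  show "B (J x) z \<bullet> y = z \<bullet> J (Bt x y)"
    using J_inner_left[of "B x z" y] Bt_inner(1)[of z x "J y"]
    by (simp add: B_J_left Bt_J_right)
qed

text \<open>\<open>B x\<close> is antilinear and \<open>Bt x\<close> complex linear in
  \<open>x\<close>, so the two terms are the (0,1) and (1,0) components; metric compatibility forces
  the second from the first.\<close>

definition nabla :: "'a \<Rightarrow> 'a \<Rightarrow> 'a" where
  "nabla x y = (1/2) *\<^sub>R (B x y - Bt x y)"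

lemma nabla_skew: "nabla x y \<bullet> z = - (y \<bullet> nabla x z)"
  by (simp add: nabla_def inner_diff_left inner_diff_right Bt_inner field_simps)

lemma nabla_J: "nabla x (J y) = J (nabla x y)"
  by (simp add: nabla_def B_J_right Bt_J_right J_simps)

lemma nabla_simps:
  "nabla (x + y) z = nabla x z + nabla y z" "nabla x (y + z) = nabla x y + nabla x z"
  "nabla (x - y) z = nabla x z - nabla y z" "nabla x (y - z) = nabla x y - nabla x z"
  "nabla (- x) y = - nabla x y" "nabla x (- y) = - nabla x y"
  "nabla (c *\<^sub>R x) y = c *\<^sub>R nabla x y" "nabla x (c *\<^sub>R y) = c *\<^sub>R nabla x y"
  "nabla 0 y = 0" "nabla x 0 = 0"
  by (simp_all add: nabla_def B_simps Bt_simps algebra_simps)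

lemma linear_nabla: "linear (nabla x)"
  by (intro linearI) (simp_all add: nabla_simps)

text \<open>A connection with the three defining properties of the Chern connection: adding the
  torsion identities for \<open>(x, y)\<close> and \<open>(x, Jy)\<close> isolates its \<open>(0,1)\<close> part, and metric
  compatibility recovers the rest.\<close>

lemma chern_connection_unique:
  assumes neg: "\<And>x y. N (- x) y = - N x y"
    and skew: "\<And>x y z. N x y \<bullet> z + y \<bullet> N x z = 0"
    and cplx: "\<And>x y. N x (J y) = J (N x y)"
    and tors: "\<And>x y. N (J x) (J y) - N (J y) (J x) - br (J x) (J y) = - (N x y - N y x - br x y)"
  shows "N x y = nabla x y"
proof -
  \<comment> \<open>Twice the part of \<open>N\<close> that is antilinear in
    \<open>x\<close>.\<close>
  define P where "P x y = N x y + J (N (J x) y)" for x y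
  have 1: "P x y - P y x = br x y + br (J x) (J y)" for x y
    using tors[of x y] by (simp add: P_def cplx algebra_simps)
  have 2: "P (J x) y = - J (P x y)" for x y
    by (simp add: P_def J_J J_simps neg)
  have 3: "P x (J y) = J (P x y)" for x y
    by (simp add: P_def cplx J_simps)
  have PB: "P x y = B x y" for x y
  proof -
    have "J (P x y) + J (P y x) = br x (J y) - br (J x) y"
      using 1[of x "J y"] by (simp add: 2 3 J_J br_simps)
    then have "J (J (P x y) + J (P y x)) = J (br x (J y) - br (J x) y)" by simp
    then have "P x y + P y x = - J (br x (J y)) + J (br (J x) y)"
      by (simp add: J_simps J_J algebra_simps)
    with 1[of x y] have "2 *\<^sub>R P x y = 2 *\<^sub>R B x y"
      unfolding scaleR_2 by (simp add: B_def br_J_J algebra_simps)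
    then show ?thesis by simp
  qed
  have "N x y \<bullet> z = nabla x y \<bullet> z" for z
  proof -
    \<comment> \<open>The operator J after \<open>N (J x)\<close> is self-adjoint, being a product
      of commuting skew operators. It drops out of \<open>P x\<close> minus its adjoint, which
      leaves twice \<open>N x\<close>.\<close>
    have "y \<bullet> J (N (J x) z) = J (N (J x) y) \<bullet> z"
      using skew[of "J x" y "J z"] J_inner_left[of "N (J x) y" z] by (simp add: cplx)
    then have "2 * (N x y \<bullet> z) = P x y \<bullet> z - y \<bullet> P x z"
      using skew[of x y z] by (simp add: P_def inner_add_left inner_add_right)
    then show ?thesis
      by (simp add: PB nabla_def inner_diff_left Bt_inner)
  qed
  then show ?thesis using vector_eq_rdot by blast
qed

section \<open>Curvature in terms of \<open>B\<close> and \<open>Bt\<close>\<close>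

definition curv :: "'a \<Rightarrow> 'a \<Rightarrow> 'a \<Rightarrow> 'a" where
  "curv x y z = nabla x (nabla y z) - nabla y (nabla x z) - nabla (br x y) z"

lemma linear_curv: "linear (curv x y)"
  by (intro linearI) (simp_all add: curv_def nabla_simps algebra_simps)

lemma curv_simps:
  "curv (x + y) z w = curv x z w + curv y z w" "curv x (y + z) w = curv x y w + curv x z w"
  "curv (- x) z w = - curv x z w" "curv x (- z) w = - curv x z w"
  "curv x y (z + w) = curv x y z + curv x y w" "curv x y (- z) = - curv x y z"
  "curv (c *\<^sub>R x) y z = c *\<^sub>R curv x y z" "curv x (c *\<^sub>R y) z = c *\<^sub>R curv x y z"
  "curv x y (c *\<^sub>R z) = c *\<^sub>R curv x y z"
  by (simp_all add: curv_def nabla_simps br_simps algebra_simps)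

lemma curv_J: "curv x y (J z) = J (curv x y z)"
  by (simp add: curv_def nabla_J J_simps)

lemma curv_antisym: "curv y x z = - curv x y z"
  by (simp add: curv_def br_skew[of y x] nabla_simps)

lemma curv_self: "curv x x z = 0"
  by (simp add: curv_def br_self nabla_simps)

lemma curv_skew: "curv x y z \<bullet> w = - (z \<bullet> curv x y w)"
  by (simp add: curv_def inner_diff_left inner_diff_right nabla_skew)

lemma br_x_Jx: "br x (J x) = J (B x x)"
  using br_skew[of "J x" x] by (simp add: B_def br_self J_simps J_J)

text \<open>Since \<open>nabla (J x)\<close> is -J (B x + Bt x) / 2, the squares of
  \<open>B x\<close> and \<open>Bt x\<close> cancel in the commutator with \<open>nabla x\<close>,
  leaving the commutator of \<open>B x\<close> with its adjoint. The last two terms come from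
  differentiation along \<open>br x (J x) = J (B x x)\<close>.\<close>

lemma J_curv_x_Jx:
  "J (curv x (J x) z) =
     (1/2) *\<^sub>R (B x (Bt x z) - Bt x (B x z) - B (B x x) z - Bt (B x x) z)"
proof -
  have "(1/4) *\<^sub>R v + (1/4) *\<^sub>R v = (1/2) *\<^sub>R v" for v :: 'a
    by (simp flip: scaleR_add_left)
  then show ?thesis
    unfolding curv_def br_x_Jx
    by (simp add: nabla_def B_simps Bt_simps B_J_left B_J_right Bt_J_left Bt_J_right J_simps J_J
        algebra_simps)
qed

text \<open>A quarter of R(X, conj X, X, conj X) for the (1,0) vector X = x - iJx, without
  normalisation.\<close>

definition hol :: "'a \<Rightarrow> real" where
  "hol x = J (curv x (J x) x) \<bullet> x"

lemma hol_eq: "hol x = ((norm (Bt x x))\<^sup>2 - (norm (B x x))\<^sup>2) / 2 - B (B x x) x \<bullet> x"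
  unfolding hol_def J_curv_x_Jx power2_norm_eq_inner
  by (simp add: inner_diff_left Bt_inner inner_commute[of x "B (B x x) x"] diff_divide_distrib)

text \<open>J commutes with \<open>nabla\<close>, so the commutator term has trace zero and only
  differentiation along the bracket remains. As \<open>J (B u z)\<close> has adjoint
  \<open>- J (Bt u z)\<close>, both halves of \<open>nabla\<close> contribute equally.\<close>

lemma tr_J_curv: "tr (\<lambda>z. J (curv x y z)) = - tr (\<lambda>z. J (B (br x y) z))"
proof -
  have "tr (\<lambda>z. J (nabla x (nabla y z))) = tr (\<lambda>z. J (nabla y (nabla x z)))"
    using tr_comp_commute[OF linear_compose[OF linear_nabla linear_J] linear_nabla, of x y]
    by (simp add: o_def nabla_J)
  moreover have "tr (\<lambda>z. J (nabla u z)) = tr (\<lambda>z. J (B u z))" for u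
  proof -
    have "adjoint (\<lambda>z. J (B u z)) = (\<lambda>z. - J (Bt u z))"
      by (rule adjoint_unique) (simp add: J_inner_left Bt_inner flip: Bt_J_right)
    then have "tr (\<lambda>z. - J (Bt u z)) = tr (\<lambda>z. J (B u z))"
      using tr_adjoint[OF linear_compose[OF linear_B linear_J], of u] by (simp add: o_def)
    then show ?thesis
      using tr_add[of "\<lambda>z. J (B u z)" "\<lambda>z. - J (Bt u z)"]
        tr_scaleR[of "1/2" "\<lambda>z. J (B u z) - J (Bt u z)"]
      by (simp add: nabla_def J_simps)
  qed
  ultimately show ?thesis
    by (simp add: curv_def J_simps tr_diff)
qed

end

section \<open>The case of a nilpotent ideal\<close>

text \<open>In the application \<open>I = \<gg>' + J\<gg>'\<close> and \<open>V k = C\<^sup>k + JC\<^sup>k\<close> for the lower central series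
  \<open>C\<close> of \<open>I\<close>. In general the \<open>V k\<close> are not subalgebras.\<close>

locale nilpotent_hermitian_lie_algebra = hermitian_lie_algebra +
  fixes I :: "'a set" and V :: "nat \<Rightarrow> 'a set" and m :: nat
  assumes subspace_I: "subspace I"
    and J_I: "x \<in> I \<Longrightarrow> J x \<in> I"
    and br_I: "br x y \<in> I"
    and V_0: "V 0 = I"
    and subspace_V: "subspace (V k)"
    and B_V: "y \<in> I \<Longrightarrow> z \<in> V k \<Longrightarrow> B y z \<in> V (Suc k)"
    and V_m: "V m = {0}"
begin

lemma B_I: "B x y \<in> I"
  unfolding B_def by (intro subspace_add[OF subspace_I] br_I J_I)

text \<open>The operator is nilpotent: it equals \<open>B (- J y)\<close> with \<open>- J y\<close>
  in \<open>I\<close>, so it shifts the filtration. The first application only reaches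
  \<open>I = V 0\<close>, whence the power \<open>Suc m\<close>.\<close>

lemma tr_J_B:
  assumes "y \<in> I"
  shows "tr (\<lambda>z. J (B y z)) = 0"
proof (rule tr_nilpotent)
  show "linear (\<lambda>z. J (B y z))"
    using linear_compose[OF linear_B linear_J] by (simp add: o_def)
  have "((\<lambda>z. J (B y z)) ^^ Suc k) x \<in> V k" for k x
  proof (induction k)
    case 0
    then show ?case by (simp add: V_0 J_I B_I)
  next
    case (Suc k)
    have "B (- J y) w \<in> V (Suc k)" if "w \<in> V k" for w
      using that assms J_I subspace_neg[OF subspace_I] by (intro B_V) auto
    then have "J (B y w) \<in> V (Suc k)" if "w \<in> V k" for w
      using that by (simp add: B_J_left B_simps)
    with Suc.IH show ?case by simp
  qed
  from this[of m] show "((\<lambda>z. J (B y z)) ^^ Suc m) x = 0" for x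
    by (simp add: V_m)
qed

lemma tr_J_curv_eq_0: "tr (\<lambda>z. J (curv x y z)) = 0"
  using tr_J_curv[of x y] tr_J_B[OF br_I] by simp

text \<open>An Engel-type argument: otherwise a nonzero element of \<open>S\<close> could be pushed
  down the filtration indefinitely, against \<open>V m = {0}\<close>. \<open>S\<close> is an
  arbitrary set so that it can be the set of values of \<open>B\<close> on \<open>I\<close>, where a
  solution is itself of the form \<open>B y z\<close>.\<close>

lemma exists_annihilated:
  assumes "S \<subseteq> I" "\<And>y z. y \<in> I \<Longrightarrow> z \<in> S \<Longrightarrow> B y z \<in> S" "s \<in> S" "s \<noteq> 0"
  shows "\<exists>w\<in>S. w \<noteq> 0 \<and> (\<forall>y\<in>I. B y w = 0)"
proof (rule ccontr)
  assume *: "\<not> ?thesis"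
  have "\<exists>w\<in>S. w \<noteq> 0 \<and> w \<in> V k" for k
  proof (induction k)
    case 0
    then show ?case using assms(1,3,4) by (auto simp: V_0)
  next
    case (Suc k)
    then obtain w where w: "w \<in> S" "w \<noteq> 0" "w \<in> V k" by blast
    with * obtain y where "y \<in> I" "B y w \<noteq> 0" by blast
    with w show ?case using assms(2) B_V by blast
  qed
  from this[of m] show False by (simp add: V_m)
qed

text \<open>If \<open>B\<close> spanned everything, \<open>I\<close> would be everything, and then
  inductively so would each \<open>V k\<close>.\<close>

lemma range_B_proper: "span {B x y | x y. True} \<noteq> UNIV"
proof
  assume *: "span {B x y | x y. True} = UNIV"
  have "span {B x y | x y. True} \<subseteq> I"
    using B_I subspace_I by (intro span_minimal) auto
  then have I: "I = UNIV" using * by auto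
  have "V k = UNIV" for k
  proof (induction k)
    case 0
    then show ?case by (simp add: V_0 I)
  next
    case (Suc k)
    have "span {B x y | x y. True} \<subseteq> V (Suc k)"
      using B_V[of _ _ k] subspace_V I Suc by (intro span_minimal) auto
    then show ?case using * by auto
  qed
  then have "UNIV = {0::'a}" using V_m by metis
  then have "b = 0" for b :: 'a by (metis UNIV_I singletonD)
  moreover obtain b :: 'a where "b \<in> Basis" using nonempty_Basis by blast
  ultimately show False using nonzero_Basis by blast
qed

lemma hol_constant_eq_0:
  assumes h: "\<And>x. hol x = c * (x \<bullet> x)\<^sup>2"
  shows "c = 0"
proof -
  obtain x where "x \<noteq> 0" and orth: "\<forall>v \<in> span {B x y | x y. True}. x \<bullet> v = 0"
    using span_not_UNIV_orthogonal[OF range_B_proper] by blast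
  have x: "x \<bullet> B y z = 0" for y z
    using orth span_base[of "B y z" "{B x y | x y. True}"] by auto
  \<comment> \<open>Orthogonality to the range of \<open>B\<close> leaves only the nonpositive term
    of \<open>hol_eq\<close>.\<close>
  have "Bt x x \<bullet> Bt x x = 0" "B (B x x) x \<bullet> x = 0"
    using x[of x "Bt x x"] x[of "B x x" x] by (simp_all add: Bt_inner inner_commute)
  then have "hol x \<le> 0" unfolding hol_eq by simp
  moreover have "(x \<bullet> x)\<^sup>2 > 0" using \<open>x \<noteq> 0\<close> by simp
  ultimately have "c \<le> 0" unfolding h by (simp add: mult_le_0_iff)
  moreover have "c \<ge> 0"
  proof (cases "I = {0}")
    case True
    then have "B y z = 0" for y z using B_I by blast
    then have "hol x \<ge> 0" unfolding hol_eq by simp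
    then show ?thesis unfolding h using \<open>(x \<bullet> x)\<^sup>2 > 0\<close> by (simp add: zero_le_mult_iff)
  next
    case False
    then obtain s where "s \<in> I" "s \<noteq> 0" using subspace_0[OF subspace_I] by blast
    then obtain w where w: "w \<in> I" "w \<noteq> 0" "\<And>y. y \<in> I \<Longrightarrow> B y w = 0"
      using exists_annihilated[of I s] B_I by blast
    \<comment> \<open>As \<open>w\<close> lies in \<open>I\<close>, \<open>B w w = 0\<close>, and
      only the nonnegative term survives.\<close>
    have "hol w \<ge> 0" unfolding hol_eq using w by (simp add: B_simps)
    moreover have "(w \<bullet> w)\<^sup>2 > 0" using w(2) by simp
    ultimately show ?thesis unfolding h by (simp add: zero_le_mult_iff)
  qed
  ultimately show ?thesis by simp
qed

section \<open>The subspace annihilated by the ideal\<close>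

definition K :: "'a set" where
  "K = {a \<in> I. \<forall>y\<in>I. B y a = 0}"

lemma K_I: "a \<in> K \<Longrightarrow> a \<in> I" and B_K_eq_0: "a \<in> K \<Longrightarrow> y \<in> I \<Longrightarrow> B y a = 0"
  by (auto simp: K_def)

lemma subspace_K: "subspace K"
  using subspace_I by (auto simp: K_def subspace_def B_simps)

text \<open>For \<open>x\<close> in \<open>I\<close>, moving \<open>B x\<close> past an arbitrary
  \<open>B y\<close> costs \<open>B\<close> of an element of \<open>I\<close>, because all brackets
  lie in \<open>I\<close>; both that term and \<open>B x\<close> kill \<open>a\<close>.\<close>

lemma B_K:
  assumes "a \<in> K"
  shows "B y a \<in> K"
proof -
  have "B x (B y a) = 0" if "x \<in> I" for x
  proof -
    have "br x y - br (J x) (J y) \<in> I"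
      by (intro subspace_diff[OF subspace_I] br_I)
    then show ?thesis
      using B_commutator[of x y a] B_K_eq_0[OF assms that] B_K_eq_0[OF assms]
      by (simp add: B_simps(10))
  qed
  then show ?thesis by (simp add: K_def B_I)
qed

text \<open>This is the vanishing of the coefficient of t^2 in
  \<open>hol (a + t *\<^sub>R y)\<close>.\<close>

lemma second_order_aux:
  assumes hol: "\<And>x. hol x = 0" and a: "a \<in> K"
  shows "(norm (Bt a y + Bt y a))\<^sup>2 - (norm (B a y + B y a))\<^sup>2 = 2 * (B (B a y + B y a) y \<bullet> a)"
proof -
  define P where "P = B a y + B y a"
  define Q where "Q = Bt a y + Bt y a"
  define q where "q = B y y"
  define s where "s = Bt y y"
  have aa: "B a a = 0" using a K_I B_K_eq_0 by blast
  \<comment> \<open>With \<open>B a a = 0\<close>, the norm of \<open>Bt a a\<close> is all that is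
    left of \<open>hol a\<close>. Thus the expansions below start in degree one.\<close>
  then have ta: "Bt a a = 0" using hol[of a] by (simp add: hol_eq B_simps)
  have PI: "B P a = 0" "B q a = 0"
    using B_K_eq_0[OF a] B_I subspace_add[OF subspace_I] by (auto simp: P_def q_def)
  have poly: "((Q \<bullet> Q - P \<bullet> P) / 2 - B P y \<bullet> a) * t^2
      + (Q \<bullet> s - P \<bullet> q - B P y \<bullet> y - B q y \<bullet> a) * t^3
      + ((s \<bullet> s - q \<bullet> q) / 2 - B q y \<bullet> y) * t^4 = 0" for t :: real
  proof -
    let ?x = "a + t *\<^sub>R y"
    have 1: "B ?x ?x = t *\<^sub>R P + t^2 *\<^sub>R q" "Bt ?x ?x = t *\<^sub>R Q + t^2 *\<^sub>R s"
      by (simp_all add: B_simps Bt_simps aa ta P_def Q_def q_def s_def power2_eq_square algebra_simps)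
    have 2: "B (B ?x ?x) ?x = t^2 *\<^sub>R B P y + t^3 *\<^sub>R B q y"
      unfolding 1 by (simp add: B_simps PI power2_eq_square power3_eq_cube algebra_simps)
    have "0 = hol ?x" by (simp add: hol)
    also have "\<dots> = ((t *\<^sub>R Q + t^2 *\<^sub>R s) \<bullet> (t *\<^sub>R Q + t^2 *\<^sub>R s)
        - (t *\<^sub>R P + t^2 *\<^sub>R q) \<bullet> (t *\<^sub>R P + t^2 *\<^sub>R q)) / 2
        - (t^2 *\<^sub>R B P y + t^3 *\<^sub>R B q y) \<bullet> ?x"
      unfolding hol_eq 2 unfolding 1 power2_norm_eq_inner ..
    finally show ?thesis
      by (simp add: inner_add_left inner_add_right inner_commute[of s Q] inner_commute[of q P]
          field_simps power_numeral_reduce)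
  qed
  have "(Q \<bullet> Q - P \<bullet> P) / 2 - B P y \<bullet> a = 0"
  proof -
    \<comment> \<open>The values 1 and -1 give \<open>q = 0\<close> and \<open>p + r = 0\<close>;
      the value 2 separates \<open>p\<close> from \<open>r\<close>.\<close>
    have "p = 0" if "\<And>t :: real. p * t^2 + q * t^3 + r * t^4 = 0" for p q r :: real
      using that[of 1] that[of "-1"] that[of 2] by simp
    from this[OF poly] show ?thesis .
  qed
  then show ?thesis
    unfolding P_def Q_def power2_norm_eq_inner by simp
qed

text \<open>Averaging over \<open>y\<close> and \<open>Jy\<close> leaves the part of degree \<open>(1,1)\<close> in \<open>y\<close>.\<close>

lemma second_order:
  assumes hol: "\<And>x. hol x = 0" and a: "a \<in> K"
  shows "(norm (Bt a y + Bt y a))\<^sup>2 - (norm (B a y))\<^sup>2 - (norm (B y a))\<^sup>2 = 2 * (B (B a y) y \<bullet> a)"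
proof -
  \<comment> \<open>\<open>Bt\<close> is linear and \<open>B\<close> antilinear in the first
    argument. Passing to \<open>J y\<close> therefore only rotates the \<open>Bt\<close> sum, but
    flips the relative sign in the \<open>B\<close> sum, and adding both versions removes the cross
    terms.\<close>
  have 1: "Bt a (J y) + Bt (J y) a = J (Bt a y + Bt y a)"
    by (simp add: Bt_J_left Bt_J_right J_simps)
  have 2: "B a (J y) + B (J y) a = J (B a y - B y a)"
    by (simp add: B_J_left B_J_right J_simps)
  have 3: "B (J u) (J y) = B u y" for u
    by (simp add: B_J_left B_J_right J_simps J_J)
  have "(norm (Bt a y + Bt y a))\<^sup>2 - (norm (B a y - B y a))\<^sup>2 = 2 * (B (B a y - B y a) y \<bullet> a)"
    using second_order_aux[OF assms, of "J y"] unfolding 1 2 3 norm_J .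
  moreover note second_order_aux[OF assms, of y]
  moreover have "(norm (B a y + B y a))\<^sup>2 + (norm (B a y - B y a))\<^sup>2
      = 2 * (norm (B a y))\<^sup>2 + 2 * (norm (B y a))\<^sup>2"
    by (simp add: power2_norm_eq_inner inner_add_left inner_add_right inner_diff_left inner_diff_right)
  ultimately show ?thesis
    by (simp add: B_simps inner_add_left inner_diff_left)
qed

text \<open>In the sum of \<open>second_order\<close> over a basis, the Hilbert-Schmidt norms of
  \<open>B a\<close> and its adjoint cancel, and the cross term of the first square cancels the
  right-hand side by \<open>sum_bilinear_adjoint\<close>.\<close>

lemma sum_norm_Bt_K:
  assumes hol: "\<And>x. hol x = 0" and a: "a \<in> K"
  shows "(\<Sum>y\<in>Basis. (norm (Bt y a))\<^sup>2) = (\<Sum>y\<in>Basis. (norm (B y a))\<^sup>2)"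
proof -
  have "(\<Sum>y\<in>Basis. (norm (Bt a y))\<^sup>2) = (\<Sum>y\<in>Basis. (norm (B a y))\<^sup>2)"
    unfolding Bt_def by (rule sum_norm_adjoint[OF linear_B])
  moreover have "(\<Sum>y\<in>Basis. Bt a y \<bullet> Bt y a) = (\<Sum>y\<in>Basis. B (B a y) y \<bullet> a)"
    using sum_bilinear_adjoint[OF linear_B bilinear_B, of a, folded Bt_def]
    by (simp add: Bt_inner flip: inner_sum_left)
  moreover have "(norm (Bt a y))\<^sup>2 + (norm (Bt y a))\<^sup>2 + 2 * (Bt a y \<bullet> Bt y a)
      - (norm (B a y))\<^sup>2 - (norm (B y a))\<^sup>2 - 2 * (B (B a y) y \<bullet> a) = 0" for y
    using second_order[OF assms, of y] dot_norm[of "Bt a y" "Bt y a"] by simp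
  then have "(\<Sum>y\<in>Basis. (norm (Bt a y))\<^sup>2 + (norm (Bt y a))\<^sup>2 + 2 * (Bt a y \<bullet> Bt y a)
      - (norm (B a y))\<^sup>2 - (norm (B y a))\<^sup>2 - 2 * (B (B a y) y \<bullet> a)) = 0"
    by simp
  ultimately show ?thesis
    by (simp add: sum.distrib sum_subtractf sum_distrib_left[symmetric])
qed

text \<open>\<open>B y\<close> preserves \<open>K\<close>, so its matrix in the basis
  \<open>X\<close> accounts for the full norms on the left. The right side reads the same matrix as
  the part of \<open>Bt y b\<close> inside \<open>K\<close>.\<close>

lemma sum_B_K:
  assumes "finite X" "orthonormal X" "span X = K"
  shows "(\<Sum>a\<in>X. (norm (B y a))\<^sup>2) = (\<Sum>b\<in>X. \<Sum>a\<in>X. (Bt y b \<bullet> a)\<^sup>2)"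
proof -
  have "(norm (B y a))\<^sup>2 = (\<Sum>b\<in>X. (Bt y b \<bullet> a)\<^sup>2)" if "a \<in> X" for a
    using parseval_norm[OF assms(1,2), of "B y a"] B_K[of a y] span_base[OF that]
    by (simp add: assms(3) Bt_inner inner_commute)
  then have "(\<Sum>a\<in>X. (norm (B y a))\<^sup>2) = (\<Sum>a\<in>X. \<Sum>b\<in>X. (Bt y b \<bullet> a)\<^sup>2)"
    by (rule sum.cong[OF refl])
  also have "\<dots> = (\<Sum>b\<in>X. \<Sum>a\<in>X. (Bt y b \<bullet> a)\<^sup>2)"
    by (rule sum.swap)
  finally show ?thesis .
qed

text \<open>Both sides of the preceding trace identity, summed over an orthonormal basis of \<open>K\<close>, are
  Hilbert--Schmidt norms; the left one is larger unless \<open>K\<close> is invariant under all adjoints.\<close>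

lemma Bt_K:
  assumes hol: "\<And>x. hol x = 0" and a: "a \<in> K"
  shows "Bt y a \<in> K"
proof -
  obtain X where X: "finite X" "orthonormal X" "span X = K"
    using orthonormal_basis_exists[OF subspace_K] .
  have XK: "x \<in> K" if "x \<in> X" for x using span_base[OF that] X(3) by simp
  \<comment> \<open>The squared distance from \<open>Bt y b\<close> to \<open>K\<close>.\<close>
  let ?d = "\<lambda>y b. (norm (Bt y b))\<^sup>2 - (\<Sum>a\<in>X. (Bt y b \<bullet> a)\<^sup>2)"
  have nonneg: "0 \<le> ?d y b" for y b using bessel[OF X(1,2)] by simp
  have "(\<Sum>b\<in>X. \<Sum>y\<in>Basis. ?d y b) = (\<Sum>b\<in>X. \<Sum>y\<in>Basis. (norm (B y b))\<^sup>2)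
      - (\<Sum>b\<in>X. \<Sum>y\<in>Basis. \<Sum>a\<in>X. (Bt y b \<bullet> a)\<^sup>2)"
    unfolding sum_subtractf
    using sum_norm_Bt_K[OF hol] XK by simp
  also have "(\<Sum>b\<in>X. \<Sum>y\<in>Basis. (norm (B y b))\<^sup>2)
      = (\<Sum>b\<in>X. \<Sum>y\<in>Basis. \<Sum>a\<in>X. (Bt y b \<bullet> a)\<^sup>2)"
    by (simp only: sum.swap[of _ Basis X] sum_B_K[OF X])
  finally have "(\<Sum>b\<in>X. \<Sum>y\<in>Basis. ?d y b) = 0" by simp
  then have "\<forall>b\<in>X. \<forall>y\<in>Basis. ?d y b = 0"
    using nonneg X(1) by (simp add: sum_nonneg_eq_0_iff sum_nonneg)
  then have base: "Bt y b \<in> K" if "y \<in> Basis" "b \<in> X" for y b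
    using bessel_eq_imp_span[OF X(1,2), of "Bt y b"] that X(3) by simp
  have all: "Bt y b \<in> K" if "b \<in> X" for y b
  proof -
    interpret l: linear "\<lambda>x. Bt x b" using bilinear_Bt by (simp add: bilinear_def)
    have "Bt y b = (\<Sum>e\<in>Basis. (y \<bullet> e) *\<^sub>R Bt e b)"
      by (subst euclidean_representation[of y, symmetric]) (simp only: l.sum l.scale)
    then show ?thesis
      using base that by (auto intro!: subspace_sum[OF subspace_K] subspace_scale[OF subspace_K])
  qed
  have "a \<in> span X" using a X(3) by simp
  then show ?thesis
  proof (induction rule: span_induct)
    case base
    show ?case using subspace_K by (simp add: subspace_def Bt_simps)
  next
    case (step x)
    then show ?case by (rule all)
  qed
qed

section \<open>From invariance of \<open>K\<close> under adjoints to flatness\<close>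

lemma Bt_I_K:
  assumes hol: "\<And>x. hol x = 0" and "a \<in> K" "y \<in> I"
  shows "Bt y a = 0"
proof -
  \<comment> \<open>\<open>Bt y a\<close> lies in \<open>K\<close>, so \<open>B y\<close> kills it;
    pairing the result with \<open>a\<close> gives the norm.\<close>
  have "Bt y a \<bullet> Bt y a = 0"
    using B_K_eq_0[OF Bt_K[OF hol assms(2)] assms(3)] by (simp add: Bt_inner)
  then show ?thesis by simp
qed

text \<open>The range of \<open>B\<close> lies in \<open>I\<close>, so \<open>Bt a u = 0\<close> and
  \<open>second_order\<close> reduces to \<open>eq\<close>. \<open>B u\<close> and
  \<open>Bt u\<close> both preserve \<open>K\<close> and have equal Hilbert-Schmidt norms there, so
  summing \<open>eq\<close> over a basis of \<open>K\<close> leaves the sum of the squared norms of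
  \<open>B b u\<close> equal to zero.\<close>

lemma orthogonal_I:
  assumes hol: "\<And>x. hol x = 0" and a: "a \<in> K" and u: "\<And>z. z \<in> I \<Longrightarrow> u \<bullet> z = 0"
  shows "B a u = 0" and "norm (Bt u a) = norm (B u a)"
proof -
  have eq: "(norm (Bt u a))\<^sup>2 = (norm (B a u))\<^sup>2 + (norm (B u a))\<^sup>2" if a: "a \<in> K" for a
  proof -
    have "Bt a u = 0"
      using u[OF B_I] by (intro Bt_eqI) (simp add: inner_commute)
    moreover have "B (B a u) u \<bullet> a = 0"
      using Bt_inner(1)[of u "B a u" a] Bt_I_K[OF hol a B_I] by simp
    ultimately show ?thesis using second_order[OF hol a, of u] by simp
  qed
  obtain X where X: "finite X" "orthonormal X" "span X = K"
    using orthonormal_basis_exists[OF subspace_K] .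
  have XK: "x \<in> K" if "x \<in> X" for x using span_base[OF that] X(3) by simp
  have "(\<Sum>b\<in>X. (norm (Bt u b))\<^sup>2) = (\<Sum>b\<in>X. \<Sum>a\<in>X. (Bt u b \<bullet> a)\<^sup>2)"
    using parseval_norm[OF X(1,2)] Bt_K[OF hol] XK X(3) by (intro sum.cong) auto
  also have "\<dots> = (\<Sum>a\<in>X. (norm (B u a))\<^sup>2)"
    by (rule sum_B_K[OF X, symmetric])
  finally have "(\<Sum>b\<in>X. (norm (B b u))\<^sup>2) = 0"
    using eq XK by (simp add: sum.distrib)
  then have 0: "B b u = 0" if "b \<in> X" for b
    using X(1) that by (simp add: sum_nonneg_eq_0_iff)
  have "a \<in> span X" using a X(3) by simp
  then show "B a u = 0"
  proof (induction rule: span_induct)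
    case base
    show ?case by (simp add: subspace_def B_simps)
  next
    case (step x)
    then show ?case by (rule 0)
  qed
  then show "norm (Bt u a) = norm (B u a)"
    using eq[OF a] by simp
qed

lemma K_eq_I:
  assumes hol: "\<And>x. hol x = 0"
  shows "K = I"
proof -
  have "B y z = 0" if "y \<in> I" "z \<in> I" for y z
  proof (rule ccontr)
    let ?S = "{B y z | y z. y \<in> I \<and> z \<in> I}"
    assume "B y z \<noteq> 0"
    moreover have "?S \<subseteq> I" using B_I by auto
    moreover from this have "B u v \<in> ?S" if "u \<in> I" "v \<in> ?S" for u v
      using that by blast
    moreover have "B y z \<in> ?S" using that by blast
    ultimately obtain w where w: "w \<in> ?S" "w \<noteq> 0" "\<forall>y\<in>I. B y w = 0"
      using exists_annihilated[of ?S "B y z"] by blast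
    then obtain y' z' where "w = B y' z'" "y' \<in> I" "z' \<in> I" by blast
    moreover have "w \<in> K" using w B_I by (auto simp: K_def)
    \<comment> \<open>Moving \<open>B y'\<close> across gives \<open>z' \<bullet> Bt y' w\<close>,
      and \<open>Bt y'\<close> kills \<open>K\<close>.\<close>
    ultimately have "w \<bullet> w = 0"
      using Bt_inner(1)[of z' y' w] Bt_I_K[OF hol] by simp
    then show False using w(2) by simp
  qed
  then show ?thesis by (auto simp: K_def)
qed

lemma decompose:
  obtains a u where "x = a + u" "a \<in> I" "\<And>z. z \<in> I \<Longrightarrow> u \<bullet> z = 0"
proof -
  obtain a u where "a \<in> span I" "\<And>w. w \<in> span I \<Longrightarrow> orthogonal u w" "x = a + u"
    using orthogonal_subspace_decomp_exists[of I x] by metis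
  moreover have "span I = I" using subspace_I by (simp only: span_eq_iff)
  ultimately show ?thesis using that by (metis orthogonal_def)
qed

lemma B_I_eq_0:
  assumes hol: "\<And>x. hol x = 0" and "a \<in> I"
  shows "B a x = 0"
proof -
  obtain b u where "x = b + u" "b \<in> I" "\<And>z. z \<in> I \<Longrightarrow> u \<bullet> z = 0"
    using decompose[of x] by blast
  then show ?thesis
    using orthogonal_I(1)[OF hol] B_K_eq_0 assms(2) unfolding K_eq_I[OF hol] by (simp add: B_simps)
qed

text \<open>Normality of \<open>B x\<close>: once \<open>x\<close> and \<open>z\<close> are split
  along \<open>I\<close>, only the part \<open>u\<close> of \<open>x\<close> orthogonal to
  \<open>I\<close> and the part \<open>b\<close> of \<open>z\<close> in \<open>I\<close> contribute,
  and \<open>orthogonal_I\<close> compares these.\<close>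

lemma norm_Bt:
  assumes hol: "\<And>x. hol x = 0"
  shows "norm (Bt x z) = norm (B x z)"
proof -
  obtain a u where x: "x = a + u" "a \<in> I" "\<And>z. z \<in> I \<Longrightarrow> u \<bullet> z = 0"
    using decompose[of x] by blast
  obtain b r where z: "z = b + r" "b \<in> I" "\<And>z. z \<in> I \<Longrightarrow> r \<bullet> z = 0"
    using decompose[of z] by blast
  \<comment> \<open>\<open>I\<close> is invariant under \<open>Bt u\<close>, so \<open>B u r\<close>
    is orthogonal to \<open>I\<close>, yet it lies in \<open>I\<close>.\<close>
  have "B u r \<bullet> B u r = 0"
  proof -
    have "Bt u (B u r) \<in> I"
      using Bt_K[OF hol] B_I unfolding K_eq_I[OF hol] by blast
    then show ?thesis using z(3) Bt_inner(1)[of r u "B u r"] by simp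
  qed
  then have "B x z = B u b"
    using B_I_eq_0[OF hol x(2)] by (simp add: x z(1) B_simps)
  moreover have "Bt u r = 0"
    using z(3)[OF B_I] by (intro Bt_eqI) (simp add: inner_commute)
  moreover have "Bt a v = 0" for v
    using B_I_eq_0[OF hol x(2)] by (intro Bt_eqI) simp
  ultimately show ?thesis
    using orthogonal_I(2)[OF hol, of b u] x(3) z(2) unfolding K_eq_I[OF hol]
    by (simp add: x(1) z(1) Bt_simps)
qed

text \<open>Equivalently, \<open>B y\<close> commutes with \<open>Bt x\<close>. Normality is
  polarised in \<open>z\<close>, then in \<open>x\<close>; inserting \<open>J x\<close> and
  \<open>J w\<close> separates the two terms, since \<open>Bt\<close> is linear and \<open>B\<close>
  antilinear in the first argument.\<close>

lemma B_normal:
  assumes hol: "\<And>x. hol x = 0"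
  shows "Bt x z \<bullet> Bt y w = B y z \<bullet> B x w"
proof -
  have 1: "Bt x z \<bullet> Bt x w = B x z \<bullet> B x w" for x z w
    using norm_Bt[OF hol, of x] by (simp add: dot_norm flip: Bt_simps B_simps)
  have 2: "Bt x z \<bullet> Bt y w + Bt y z \<bullet> Bt x w = B x z \<bullet> B y w + B y z \<bullet> B x w" for x y z w
    using 1[of "x + y" z w] by (simp add: 1 Bt_simps B_simps inner_add_left inner_add_right)
  have "Bt x z \<bullet> Bt y w - Bt y z \<bullet> Bt x w = B y z \<bullet> B x w - B x z \<bullet> B y w"
    using 2[of "J x" z y "J w"]
    by (simp add: Bt_J_left Bt_J_right B_J_left B_J_right J_isometry J_J J_simps)
  with 2[of x z y w] show ?thesis by simp
qed

lemma hol_eq_0_imp_flat: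
  assumes hol: "\<And>x. hol x = 0"
  shows "curv x y z = 0"
proof -
  have "nabla u v = 0" if "u \<in> I" for u v
  proof -
    have "Bt u v = 0" using B_I_eq_0[OF hol that] by (intro Bt_eqI) simp
    then show ?thesis by (simp add: nabla_def B_I_eq_0[OF hol that])
  qed
  then have "nabla (br x y) z = 0" using br_I by blast
  moreover have "br x y - br (J x) (J y) \<in> I"
    by (intro subspace_diff[OF subspace_I] br_I)
  then have comm: "B x (B y v) = B y (B x v)" for v
    using B_commutator[of x y v] B_I_eq_0[OF hol] by simp
  have "nabla x (nabla y z) \<bullet> w = nabla y (nabla x z) \<bullet> w" for w
  proof -
    have "B y z \<bullet> Bt x w = B x z \<bullet> Bt y w" "Bt y z \<bullet> B x w = Bt x z \<bullet> B y w"
      using comm[of z] comm[of w] by (simp_all add: Bt_inner)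
    \<comment> \<open>Skewness reduces commutation of \<open>nabla x\<close> and
      \<open>nabla y\<close> to this symmetry. Products of \<open>B\<close> with \<open>Bt\<close>
      match because the \<open>B\<close> operators commute, the others by
      \<open>B_normal\<close>.\<close>
    then have "nabla y z \<bullet> nabla x w = nabla x z \<bullet> nabla y w"
      using B_normal[OF hol, of x z y w] B_normal[OF hol, of y z x w]
      by (simp add: nabla_def inner_diff_left inner_diff_right diff_divide_distrib)
    then show ?thesis
      using nabla_skew[of x "nabla y z" w] nabla_skew[of y "nabla x z" w] by simp
  qed
  then have "nabla x (nabla y z) = nabla y (nabla x z)" using vector_eq_rdot by blast
  ultimately show ?thesis by (simp add: curv_def)
qed

end

section \<open>Smooth functions and left-invariant vector fields\<close>

lemma Ck_on_cong:
  assumes "open S" "\<And>x. x \<in> S \<Longrightarrow> f x = g x" "Ck_on k S f"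
  shows "Ck_on k S g"
  using assms(2,3)
proof (induction k arbitrary: f g)
  case 0
  then show ?case using continuous_on_cong by fastforce
next
  case (Suc k)
  have f: "f differentiable (at x)" if "x \<in> S" for x
    using Suc.prems(2) that assms(1) by (simp add: differentiable_on_eq_differentiable_at)
  have "(g has_derivative frechet_derivative f (at x)) (at x)" if "x \<in> S" for x
    using f[OF that] Suc.prems(1) assms(1) that
    by (metis frechet_derivative_works has_derivative_transform_within_open)
  then have "g differentiable_on S" "\<And>x. x \<in> S \<Longrightarrow> frechet_derivative f (at x) = frechet_derivative g (at x)"
    using assms(1) frechet_derivative_at
    by (auto simp: differentiable_on_eq_differentiable_at differentiable_def)
  then show ?case
    using Suc.IH[of "\<lambda>x. frechet_derivative f (at x) v" "\<lambda>x. frechet_derivative g (at x) v" for v]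
      Suc.prems(2) by auto
qed

lemma Ck_on_const: "Ck_on k S (\<lambda>_. c)"
  by (induction k arbitrary: c) simp_all

lemma Ck_on_SucD: "Ck_on (Suc k) S f \<Longrightarrow> Ck_on k S f"
proof (induction k arbitrary: f)
  case 0
  then show ?case by (simp add: differentiable_imp_continuous_on)
next
  case (Suc k)
  from Suc.prems have "f differentiable_on S" "\<forall>v. Ck_on (Suc k) S (\<lambda>x. frechet_derivative f (at x) v)"
    by simp_all
  then show ?case using Suc.IH by simp
qed

text \<open>Lets the closure properties below use an explicit derivative \<open>f'\<close>; it
  agrees with \<open>frechet_derivative\<close> only on \<open>S\<close>, which suffices as
  \<open>S\<close> is open.\<close>

lemma Ck_on_SucI:
  assumes "open S" "\<And>x. x \<in> S \<Longrightarrow> (f has_derivative f' x) (at x)" "\<And>v. Ck_on k S (\<lambda>x. f' x v)"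
  shows "Ck_on (Suc k) S f"
proof -
  have "f' x v = frechet_derivative f (at x) v" if "x \<in> S" for x v
    using frechet_derivative_at[OF assms(2)[OF that]] by simp
  then have "Ck_on k S (\<lambda>x. frechet_derivative f (at x) v)" for v
    by (intro Ck_on_cong[OF assms(1) _ assms(3)])
  moreover have "f differentiable_on S"
    using assms(1,2) by (auto simp: differentiable_on_eq_differentiable_at differentiable_def)
  ultimately show ?thesis by simp
qed

lemma Ck_on_Suc_has_derivative:
  "open S \<Longrightarrow> Ck_on (Suc k) S f \<Longrightarrow> x \<in> S \<Longrightarrow> (f has_derivative frechet_derivative f (at x)) (at x)"
  by (simp add: differentiable_on_eq_differentiable_at frechet_derivative_works)

lemma Ck_on_add:
  assumes "open S"
  shows "Ck_on k S f \<Longrightarrow> Ck_on k S g \<Longrightarrow> Ck_on k S (\<lambda>x. f x + g x)"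
proof (induction k arbitrary: f g)
  case 0
  then show ?case by (simp add: continuous_on_add)
next
  case (Suc k)
  show ?case
  proof (rule Ck_on_SucI[OF assms])
    show "((\<lambda>x. f x + g x) has_derivative
        (\<lambda>v. frechet_derivative f (at x) v + frechet_derivative g (at x) v)) (at x)" if "x \<in> S" for x
      using Ck_on_Suc_has_derivative[OF assms _ that] Suc.prems by (intro has_derivative_add) blast+
    show "Ck_on k S (\<lambda>x. frechet_derivative f (at x) v + frechet_derivative g (at x) v)" for v
      using Suc.prems by (intro Suc.IH) auto
  qed
qed

lemma Ck_on_scaleR:
  assumes "open S"
  shows "Ck_on k S f \<Longrightarrow> Ck_on k S (\<lambda>x. c *\<^sub>R f x)"
proof (induction k arbitrary: f)
  case 0
  then show ?case by (simp add: continuous_on_scaleR)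
next
  case (Suc k)
  show ?case
  proof (rule Ck_on_SucI[OF assms])
    show "((\<lambda>x. c *\<^sub>R f x) has_derivative (\<lambda>v. c *\<^sub>R frechet_derivative f (at x) v)) (at x)"
      if "x \<in> S" for x
      using Ck_on_Suc_has_derivative[OF assms _ that] Suc.prems
      by (intro has_derivative_scaleR_right) blast
    show "Ck_on k S (\<lambda>x. c *\<^sub>R frechet_derivative f (at x) v)" for v
      using Suc.prems by (intro Suc.IH) auto
  qed
qed

lemma Ck_on_mult:
  fixes f g :: "'a::real_normed_vector \<Rightarrow> real"
  assumes "open S"
  shows "Ck_on k S f \<Longrightarrow> Ck_on k S g \<Longrightarrow> Ck_on k S (\<lambda>x. f x * g x)"
proof (induction k arbitrary: f g)
  case 0
  then show ?case by (simp add: continuous_on_mult)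
next
  case (Suc k)
  show ?case
  proof (rule Ck_on_SucI[OF assms])
    show "((\<lambda>x. f x * g x) has_derivative
        (\<lambda>v. f x * frechet_derivative g (at x) v + frechet_derivative f (at x) v * g x)) (at x)"
      if "x \<in> S" for x
      using Ck_on_Suc_has_derivative[OF assms _ that] Suc.prems by (intro has_derivative_mult) blast+
    show "Ck_on k S (\<lambda>x. f x * frechet_derivative g (at x) v + frechet_derivative f (at x) v * g x)"
      for v
      using Suc.prems Ck_on_SucD[OF Suc.prems(1)] Ck_on_SucD[OF Suc.prems(2)]
      by (intro Ck_on_add[OF assms] Suc.IH) auto
  qed
qed

lemma smooth_atlas_open: "smooth_atlas A \<Longrightarrow> (U, \<phi>) \<in> A \<Longrightarrow> open (\<phi> ` U)"
  by (auto simp: smooth_atlas_def)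

lemma smooth_fun_const: "smooth_fun A (\<lambda>_. c)"
  by (simp add: smooth_fun_def smooth_on_def Ck_on_const split: prod.split)

lemma smooth_fun_add:
  "smooth_atlas A \<Longrightarrow> smooth_fun A f \<Longrightarrow> smooth_fun A g \<Longrightarrow> smooth_fun A (\<lambda>x. f x + g x)"
  using smooth_atlas_open Ck_on_add unfolding smooth_fun_def smooth_on_def by fast

lemma smooth_fun_scaleR:
  "smooth_atlas A \<Longrightarrow> smooth_fun A f \<Longrightarrow> smooth_fun A (\<lambda>x. c *\<^sub>R f x)"
  using smooth_atlas_open Ck_on_scaleR unfolding smooth_fun_def smooth_on_def by fast

lemma smooth_fun_diff:
  "smooth_atlas A \<Longrightarrow> smooth_fun A f \<Longrightarrow> smooth_fun A g \<Longrightarrow> smooth_fun A (\<lambda>x. f x - g x)"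
  using smooth_fun_add[of A f "\<lambda>x. (-1) *\<^sub>R g x"] smooth_fun_scaleR[of A g "-1"] by simp

lemma smooth_fun_mult:
  fixes f g :: "'g::topological_space \<Rightarrow> real"
  shows "smooth_atlas A \<Longrightarrow> smooth_fun A f \<Longrightarrow> smooth_fun A g \<Longrightarrow> smooth_fun A (\<lambda>x. f x * g x)"
  using smooth_atlas_open Ck_on_mult unfolding smooth_fun_def smooth_on_def by fast

section \<open>Vector fields as derivations\<close>

lemma vector_fieldD:
  assumes "vector_field A Y"
  shows "smooth_fun A f \<Longrightarrow> smooth_fun A (Y f)"
    and "smooth_fun A f \<Longrightarrow> smooth_fun A h \<Longrightarrow> Y (\<lambda>x. f x + h x) = (\<lambda>p. Y f p + Y h p)"
    and "smooth_fun A f \<Longrightarrow> Y (\<lambda>x. r * f x) = (\<lambda>p. r * Y f p)"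
    and "smooth_fun A f \<Longrightarrow> smooth_fun A h \<Longrightarrow> Y (\<lambda>x. f x * h x) = (\<lambda>p. Y f p * h p + f p * Y h p)"
    and "\<not> smooth_fun A f \<Longrightarrow> Y f = (\<lambda>_. 0)"
  using assms by (simp_all add: vector_field_def) (simp_all add: fun_eq_iff)

lemma vector_field_const:
  assumes "vector_field A Y"
  shows "Y (\<lambda>_. c) = (\<lambda>_. 0)"
proof -
  have "Y (\<lambda>_. 1) p = 0" for p
    using fun_cong[OF vector_fieldD(4)[OF assms smooth_fun_const[of A 1] smooth_fun_const[of A 1]], of p]
    by simp
  then show ?thesis
    using vector_fieldD(3)[OF assms smooth_fun_const[of A 1], of c] by simp
qed

lemma vector_field_diff:
  assumes "smooth_atlas A" "vector_field A Y" "smooth_fun A f" "smooth_fun A h"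
  shows "Y (\<lambda>x. f x - h x) = (\<lambda>p. Y f p - Y h p)"
  using vector_fieldD(2)[OF assms(2,3) smooth_fun_scaleR[OF assms(1,4), of "-1"]]
    vector_fieldD(3)[OF assms(2,4), of "-1"] by simp

lemma vector_field_commutator:
  assumes A: "smooth_atlas A" and Y: "vector_field A Y" and Z: "vector_field A Z"
  shows "vector_field A (\<lambda>f p. Y (Z f) p - Z (Y f) p)"
  unfolding vector_field_def
proof (intro conjI allI impI)
  fix f h :: "_ \<Rightarrow> real" and p and r :: real
  assume f: "smooth_fun A f"
  note Yf = vector_fieldD(1)[OF Y f] and Zf = vector_fieldD(1)[OF Z f]
  show "smooth_fun A (\<lambda>p. Y (Z f) p - Z (Y f) p)"
    by (intro smooth_fun_diff[OF A] vector_fieldD(1)[OF Y] vector_fieldD(1)[OF Z] f)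
  show "Y (Z (\<lambda>x. r * f x)) p - Z (Y (\<lambda>x. r * f x)) p = r * (Y (Z f) p - Z (Y f) p)"
    by (simp add: vector_fieldD(3)[OF Y] vector_fieldD(3)[OF Z] f Yf Zf right_diff_distrib)
  assume h: "smooth_fun A h"
  note Yh = vector_fieldD(1)[OF Y h] and Zh = vector_fieldD(1)[OF Z h]
  show "Y (Z (\<lambda>x. f x + h x)) p - Z (Y (\<lambda>x. f x + h x)) p
      = Y (Z f) p - Z (Y f) p + (Y (Z h) p - Z (Y h) p)"
    by (simp add: vector_fieldD(2)[OF Y] vector_fieldD(2)[OF Z] f h Yf Zf Yh Zh)
  show "Y (Z (\<lambda>x. f x * h x)) p - Z (Y (\<lambda>x. f x * h x)) p
      = (Y (Z f) p - Z (Y f) p) * h p + f p * (Y (Z h) p - Z (Y h) p)"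
    by (simp add: vector_fieldD(2,4)[OF Y] vector_fieldD(2,4)[OF Z] f h Yf Zf Yh Zh
        smooth_fun_mult[OF A] algebra_simps)
next
  fix f :: "_ \<Rightarrow> real"
  assume "\<not> smooth_fun A f"
  \<comment> \<open>On such \<open>f\<close> the inner fields return the zero function by
    convention, and the outer ones kill constants.\<close>
  then show "(\<lambda>p. Y (Z f) p - Z (Y f) p) = (\<lambda>_. 0)"
    by (simp add: vector_fieldD(5)[OF Y] vector_fieldD(5)[OF Z] vector_field_const[OF Y]
        vector_field_const[OF Z])
qed

section \<open>The Lie algebra of left-invariant fields\<close>

context lie_group_algebra
begin

lemma vector_field_E: "vector_field A (E u)" and left_invariant_E: "left_invariant (E u)"
  using bij_E by (auto simp: bij_betw_def)

lemmas E_D = vector_fieldD[OF vector_field_E]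

lemma E_eqI:
  assumes "\<And>f p. smooth_fun A f \<Longrightarrow> E u f p = E v f p"
  shows "u = v"
proof -
  have "E u f = E v f" for f
    using assms by (cases "smooth_fun A f") (auto simp: E_D(5))
  then have "E u = E v" by blast
  then show ?thesis using bij_E by (auto simp: bij_betw_def dest: injD)
qed

text \<open>\<open>the_inv E\<close> is meaningful only on the range of \<open>E\<close>, so the
  point is that the commutator of left-invariant fields is again a left-invariant field.\<close>

lemma E_bracket: "E (bracket u v) f p = E u (E v f) p - E v (E u f) p"
proof -
  let ?C = "\<lambda>f p. E u (E v f) p - E v (E u f) p"
  have "left_invariant ?C"
    unfolding left_invariant_def
  proof (intro allI impI)
    fix a and f :: "'g \<Rightarrow> real"
    assume f: "smooth_fun A f"
    have L: "E w (\<lambda>x. h (a \<otimes> x)) = (\<lambda>x. E w h (a \<otimes> x))" if "smooth_fun A h" for w h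
      using left_invariant_E that unfolding left_invariant_def by blast
    show "(\<lambda>p. E u (E v (\<lambda>x. f (a \<otimes> x))) p - E v (E u (\<lambda>x. f (a \<otimes> x))) p)
        = (\<lambda>x. E u (E v f) (a \<otimes> x) - E v (E u f) (a \<otimes> x))"
      by (simp add: L f E_D(1))
  qed
  then have "?C \<in> range E"
    using bij_E vector_field_commutator[OF atlas vector_field_E vector_field_E]
    by (simp add: bij_betw_def)
  then have "E (bracket u v) = ?C"
    unfolding bracket_def using bij_E by (intro f_the_inv_into_f) (simp_all add: bij_betw_def)
  then show ?thesis by simp
qed

lemma E_minus: "E (- u) f p = - E u f p"
  using E_scaleR[of "-1" u] by simp

lemma E_add_fun: "E (u + v) f = (\<lambda>p. E u f p + E v f p)"
  and E_scaleR_fun: "E (r *\<^sub>R u) f = (\<lambda>p. r * E u f p)"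
  by (auto simp: E_add E_scaleR)

lemma bilinear_bracket: "bilinear bracket"
  unfolding bilinear_def
  by (intro conjI allI linearI; rule E_eqI)
    (simp_all add: E_bracket E_add_fun E_scaleR_fun E_D algebra_simps)

lemma bracket_skew: "bracket u v = - bracket v u"
  by (rule E_eqI) (simp add: E_bracket E_minus)

lemma bracket_jacobi:
  "bracket x (bracket y z) = bracket (bracket x y) z + bracket y (bracket x z)"
proof (rule E_eqI)
  fix f :: "'g \<Rightarrow> real" and p
  assume f: "smooth_fun A f"
  have e: "E (bracket u v) f = (\<lambda>p. E u (E v f) p - E v (E u f) p)" for u v f
    by (simp add: E_bracket fun_eq_iff)
  show "E (bracket x (bracket y z)) f p = E (bracket (bracket x y) z + bracket y (bracket x z)) f p"
    by (simp add: E_add e f E_D(1) vector_field_diff[OF atlas vector_field_E])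
qed

end

section \<open>The Chern connection of a Lie-Hermitian manifold\<close>

context lie_hermitian
begin

sublocale hermitian_lie_algebra bracket J
  by (rule hermitian_lie_algebra.intro)
    (rule bilinear_bracket bracket_skew bracket_jacobi linear_J J_J J_integrable J_isometry)+

lemma smoothM_const: "smoothM (\<lambda>_. c)"
  by (simp add: smoothM_def smooth_fun_const)

lemma smoothM_diff: "smoothM f \<Longrightarrow> smoothM g \<Longrightarrow> smoothM (\<lambda>m. f m - g m)"
  unfolding smoothM_def by (rule smooth_fun_diff[OF atlas])

lemma coset_in_M: "\<Gamma> #> p \<in> M"
  unfolding M_def using subgroup_\<Gamma> carrier_UNIV by (intro rcosetsI) auto

lemma deriv_along_const: "deriv_along V (\<lambda>_. c) m = 0"
  by (simp add: deriv_along_def vector_field_const[OF vector_field_E])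

lemma field_bracket_const: "field_bracket (\<lambda>_. x) (\<lambda>_. y) = (\<lambda>_. bracket x y)"
  by (simp add: field_bracket_def deriv_along_const fun_eq_iff)

lemma chern_connectionD:
  assumes "chern_connection D"
  shows "smoothM V \<Longrightarrow> smoothM W \<Longrightarrow> smoothM (D V W)"
    and "smoothM f \<Longrightarrow> smoothM V \<Longrightarrow> smoothM W \<Longrightarrow> m \<in> M \<Longrightarrow>
      D (\<lambda>m. f m *\<^sub>R V m) W m = f m *\<^sub>R D V W m"
    and "smoothM V \<Longrightarrow> smoothM W \<Longrightarrow> smoothM W' \<Longrightarrow> m \<in> M \<Longrightarrow>
      D V (\<lambda>m. W m + W' m) m = D V W m + D V W' m"
    and "smoothM f \<Longrightarrow> smoothM V \<Longrightarrow> smoothM W \<Longrightarrow> m \<in> M \<Longrightarrow>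
      D V (\<lambda>m. f m *\<^sub>R W m) m = deriv_along V f m *\<^sub>R W m + f m *\<^sub>R D V W m"
    and "smoothM U \<Longrightarrow> smoothM V \<Longrightarrow> smoothM W \<Longrightarrow> m \<in> M \<Longrightarrow>
      deriv_along U (\<lambda>m. V m \<bullet> W m) m = D U V m \<bullet> W m + V m \<bullet> D U W m"
    and "smoothM V \<Longrightarrow> smoothM W \<Longrightarrow> m \<in> M \<Longrightarrow> D V (\<lambda>m. J (W m)) m = J (D V W m)"
    and "smoothM V \<Longrightarrow> smoothM W \<Longrightarrow> m \<in> M \<Longrightarrow>
      torsion D (\<lambda>m. J (V m)) (\<lambda>m. J (W m)) m = - torsion D V W m"
  using assms unfolding chern_connection_def connection_def by simp_all

lemma D_left_invariant:
  assumes D: "chern_connection D" and m: "m \<in> M"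
  shows "D (\<lambda>_. x) (\<lambda>_. y) m = nabla x y"
proof (rule chern_connection_unique)
  note C = chern_connectionD[OF D]
  fix x y z
  show "D (\<lambda>_. - x) (\<lambda>_. y) m = - D (\<lambda>_. x) (\<lambda>_. y) m"
    using C(2)[of "\<lambda>_. -1" "\<lambda>_. x" "\<lambda>_. y" m] m by (simp add: smoothM_const)
  show "D (\<lambda>_. x) (\<lambda>_. y) m \<bullet> z + y \<bullet> D (\<lambda>_. x) (\<lambda>_. z) m = 0"
    using C(5)[of "\<lambda>_. x" "\<lambda>_. y" "\<lambda>_. z" m] m by (simp add: smoothM_const deriv_along_const)
  show "D (\<lambda>_. x) (\<lambda>_. J y) m = J (D (\<lambda>_. x) (\<lambda>_. y) m)"
    using C(6)[of "\<lambda>_. x" "\<lambda>_. y" m] m by (simp add: smoothM_const)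
  show "D (\<lambda>_. J x) (\<lambda>_. J y) m - D (\<lambda>_. J y) (\<lambda>_. J x) m - bracket (J x) (J y)
      = - (D (\<lambda>_. x) (\<lambda>_. y) m - D (\<lambda>_. y) (\<lambda>_. x) m - bracket x y)"
    using C(7)[of "\<lambda>_. x" "\<lambda>_. y" m] m
    by (simp add: smoothM_const torsion_def field_bracket_const)
qed

text \<open>The values of a field outside \<open>M\<close> do not matter: a field vanishing on \<open>M\<close> is its own
  product with the indicator function of the complement of \<open>M\<close>, which is smooth.\<close>

lemma D_cong:
  assumes D: "chern_connection D" and m: "m \<in> M"
    and V: "smoothM V" and W: "smoothM W" and W': "smoothM W'"
    and eq: "\<And>m. m \<in> M \<Longrightarrow> W m = W' m"
  shows "D V W m = D V W' m"
proof -
  note C = chern_connectionD[OF D]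
  define N where "N m = W m - W' m" for m
  define f :: "'g set \<Rightarrow> real" where "f m = (if m \<in> M then 0 else 1)" for m
  have N: "smoothM N" unfolding N_def by (rule smoothM_diff[OF W W'])
  \<comment> \<open>Smoothness is tested on the pullback to \<open>G\<close>, which is identically
    zero since every coset lies in \<open>M\<close>.\<close>
  have f: "smoothM f"
    using smooth_fun_const[of A "0::real"] by (simp add: smoothM_def f_def coset_in_M)
  have "N = (\<lambda>m. f m *\<^sub>R N m)" by (auto simp: N_def f_def eq)
  then have "D V N m = D V (\<lambda>m. f m *\<^sub>R N m) m" by simp
  also have "\<dots> = 0"
    using C(4)[OF f V N m] m by (simp add: f_def N_def eq)
  finally have "D V N m = 0" .
  moreover have "W = (\<lambda>m. W' m + N m)" by (simp add: N_def)
  ultimately show ?thesis using C(3)[OF V W' N m] by simp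
qed

lemma Rm_eq:
  assumes D: "chern_connection D" and m: "m \<in> M"
  shows "Rm D m x y z w = curv x y z \<bullet> w"
proof -
  have "D (\<lambda>_. u) (D (\<lambda>_. v) (\<lambda>_. z)) m = nabla u (nabla v z)" for u v
  proof -
    \<comment> \<open>The inner derivative is known to be constant only on \<open>M\<close>, hence
      the appeal to \<open>D_cong\<close>.\<close>
    have "D (\<lambda>_. u) (D (\<lambda>_. v) (\<lambda>_. z)) m = D (\<lambda>_. u) (\<lambda>_. nabla v z) m"
      by (rule D_cong[OF D m])
        (simp_all add: smoothM_const chern_connectionD(1)[OF D] D_left_invariant[OF D])
    then show ?thesis by (simp add: D_left_invariant[OF D m])
  qed
  then show ?thesis
    by (simp add: Rm_def curvature_def field_bracket_const D_left_invariant[OF D m] curv_def)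
qed

subsection \<open>Unitary frames\<close>

text \<open>Orthonormality over the complex numbers, with J as multiplication by i. Up to the factor
  \<open>sqrt 2\<close>, these are the real parts of the vectors of a unitary family of type
  (1,0).\<close>

definition complex_orthonormal :: "'a set \<Rightarrow> bool" where
  "complex_orthonormal U \<longleftrightarrow>
     finite U \<and> (\<forall>u\<in>U. \<forall>v\<in>U. u \<bullet> v = (if u = v then 1 else 0) \<and> u \<bullet> J v = 0)"

lemma J_eq_iff: "J x = J y \<longleftrightarrow> x = y"
  by (metis J_J minus_minus)

lemma complex_orthonormal_real_basis:
  assumes "complex_orthonormal U"
  shows "orthonormal (U \<union> J ` U)" and "card (U \<union> J ` U) = 2 * card U" and "U \<inter> J ` U = {}"
proof -
  have U: "u \<bullet> v = (if u = v then 1 else 0)" "u \<bullet> J v = 0" "J u \<bullet> v = 0" "J u \<bullet> J v = u \<bullet> v"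
    if "u \<in> U" "v \<in> U" for u v
    using that assms by (auto simp: complex_orthonormal_def J_inner_left J_isometry J_J)
  have ne: "u \<noteq> J v" if "u \<in> U" "v \<in> U" for u v
    using U(1)[OF that(1) that(1)] U(2)[OF that] by auto
  then show disj: "U \<inter> J ` U = {}" by auto
  show "orthonormal (U \<union> J ` U)"
  proof (rule orthonormalI)
    fix x y assume "x \<in> U \<union> J ` U" "y \<in> U \<union> J ` U"
    then consider "x \<in> U" "y \<in> U" | v where "x \<in> U" "v \<in> U" "y = J v"
      | u where "u \<in> U" "x = J u" "y \<in> U" | u v where "u \<in> U" "v \<in> U" "x = J u" "y = J v"
      by blast
    then show "x \<bullet> y = (if x = y then 1 else 0)"
    proof cases
      case 1
      then show ?thesis by (rule U(1))
    next
      case 2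
      then show ?thesis using U(2) ne by simp
    next
      case 3
      then show ?thesis using U(3) ne[of y u] by auto
    next
      case 4
      then show ?thesis using U(1,4) by (simp add: J_eq_iff)
    qed
  qed
  have "finite U" using assms by (simp add: complex_orthonormal_def)
  then show "card (U \<union> J ` U) = 2 * card U"
    using disj by (simp add: card_Un_disjoint card_image inj_on_def J_eq_iff)
qed

lemma complex_orthonormal_card_le:
  assumes "complex_orthonormal U"
  shows "2 * card U \<le> DIM('a)"
  using complex_orthonormal_real_basis[OF assms] orthonormal_independent independent_bound by metis

lemma complex_orthonormal_extend:
  assumes U: "complex_orthonormal U" and less: "2 * card U < DIM('a)"
  shows "\<exists>v. complex_orthonormal (insert v U) \<and> v \<notin> U"
proof -
  let ?X = "U \<union> J ` U"
  have "finite U" using U by (simp add: complex_orthonormal_def)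
  then have "dim ?X < DIM('a)"
    using dim_le_card'[of ?X] complex_orthonormal_real_basis(2)[OF U] less by simp
  then obtain x where x: "x \<noteq> 0" "\<And>y. y \<in> span ?X \<Longrightarrow> orthogonal x y"
    using orthogonal_to_subspace_exists by blast
  define v where "v = x /\<^sub>R norm x"
  have v: "v \<bullet> v = 1" using x(1) by (simp add: v_def power2_norm_eq_inner[symmetric] power2_eq_square)
  have vU: "v \<bullet> u = 0" "v \<bullet> J u = 0" if "u \<in> U" for u
    using x(2)[OF span_base, of u] x(2)[OF span_base, of "J u"] that
    by (simp_all add: v_def orthogonal_def)
  have Uv: "u \<bullet> v = 0" "u \<bullet> J v = 0" if "u \<in> U" for u
    using vU[OF that] J_inner_left[of u v] by (simp_all add: inner_commute)
  have "v \<notin> U" using v vU(1) by auto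
  moreover have "complex_orthonormal (insert v U)"
    unfolding complex_orthonormal_def
  proof (intro conjI ballI)
    show "finite (insert v U)" using \<open>finite U\<close> by simp
    fix u w assume "u \<in> insert v U" "w \<in> insert v U"
    then show "u \<bullet> w = (if u = w then 1 else 0)" "u \<bullet> J w = 0"
      using U v vU Uv \<open>v \<notin> U\<close> by (auto simp: complex_orthonormal_def)
  qed
  ultimately show ?thesis by blast
qed

lemma complex_orthonormal_basis_exists:
  "\<exists>U. complex_orthonormal U \<and> 2 * card U = DIM('a)"
proof -
  have "complex_orthonormal {}" by (simp add: complex_orthonormal_def)
  moreover have "card U \<le> DIM('a)" if "complex_orthonormal U" for U
    using complex_orthonormal_card_le[OF that] by simp
  ultimately have "\<exists>U. complex_orthonormal U \<and> (\<forall>U'. complex_orthonormal U' \<longrightarrow> card U' \<le> card U)"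
    by (intro ex_has_greatest_nat[of complex_orthonormal "{}" card "Suc DIM('a)"]) (auto simp: less_Suc_eq_le)
  then obtain U where U: "complex_orthonormal U"
    and max: "\<And>U'. complex_orthonormal U' \<Longrightarrow> card U' \<le> card U" by blast
  have "\<not> 2 * card U < DIM('a)"
  proof
    assume "2 * card U < DIM('a)"
    then obtain v where "complex_orthonormal (insert v U)" "v \<notin> U"
      using complex_orthonormal_extend[OF U] by blast
    moreover have "finite U" using U by (simp add: complex_orthonormal_def)
    ultimately show False using max by fastforce
  qed
  then show ?thesis using U complex_orthonormal_card_le[OF U] by (intro exI[of _ U]) simp
qed

lemma tr_complex_orthonormal:
  assumes U: "complex_orthonormal U" "2 * card U = DIM('a)"
    and f: "linear f" "\<And>x. f (J x) = J (f x)"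
  shows "tr f = 2 * (\<Sum>u\<in>U. f u \<bullet> u)"
proof -
  let ?X = "U \<union> J ` U"
  have fin: "finite U" using U by (simp add: complex_orthonormal_def)
  note X = complex_orthonormal_real_basis[OF U(1)]
  have "span ?X = UNIV"
    using X(1,2) U(2) orthonormal_independent
    by (metis dim_eq_card_independent dim_eq_full)
  then have "tr f = (\<Sum>x\<in>?X. f x \<bullet> x)"
    using tr_orthonormal[OF _ X(1) _ f(1)] fin by simp
  also have "\<dots> = (\<Sum>u\<in>U. f u \<bullet> u) + (\<Sum>x\<in>J ` U. f x \<bullet> x)"
    using fin X(3) by (simp add: sum.union_disjoint)
  also have "(\<Sum>x\<in>J ` U. f x \<bullet> x) = (\<Sum>u\<in>U. f u \<bullet> u)"
    by (subst sum.reindex) (simp_all add: inj_on_def J_eq_iff f(2) J_isometry)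
  finally show ?thesis by simp
qed

lemma type10_iff: "type10 X \<longleftrightarrow> snd X = - J (fst X)"
  by (cases X) (auto simp: type10_def J_J J_simps)

lemma herm_type10:
  assumes "type10 X" "type10 Y"
  shows "herm X Y = complex_of_real (2 * (fst X \<bullet> fst Y)) + \<i> * complex_of_real (2 * (fst X \<bullet> J (fst Y)))"
  using assms by (simp add: type10_iff herm_def cext_def conj_vec_def J_inner_left J_J algebra_simps)

lemma unitary_frame_exists: "\<exists>F. unitary_frame F"
proof -
  obtain U where U: "complex_orthonormal U" "2 * card U = DIM('a)"
    using complex_orthonormal_basis_exists by blast
  \<comment> \<open>The vector u - iJu has Hermitian square 2 |u|^2, whence the factor.\<close>
  let ?g = "\<lambda>u. ((1 / sqrt 2) *\<^sub>R u, - J ((1 / sqrt 2) *\<^sub>R u))"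
  have inj: "inj_on ?g U" by (auto simp: inj_on_def)
  have "unitary_frame (?g ` U)"
    unfolding unitary_frame_def
  proof (intro conjI ballI)
    show "finite (?g ` U)" using U by (simp add: complex_orthonormal_def)
    show "2 * card (?g ` U) = DIM('a)" using U(2) by (simp add: card_image[OF inj])
    fix e assume "e \<in> ?g ` U"
    then obtain u where u: "u \<in> U" "e = ?g u" by blast
    show "type10 e" by (simp add: u type10_iff)
    fix f assume "f \<in> ?g ` U"
    then obtain v where v: "v \<in> U" "f = ?g v" by blast
    have "type10 e" "type10 f" by (simp_all add: u v type10_iff)
    from herm_type10[OF this] show "herm e f = (if e = f then 1 else 0)"
      using U(1) u v by (auto simp: complex_orthonormal_def J_simps)
  qed
  then show ?thesis by blast
qed

lemma unitary_frame_complex_orthonormal: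
  assumes "unitary_frame F"
  defines "g \<equiv> \<lambda>e. sqrt 2 *\<^sub>R fst e"
  shows "inj_on g F" and "complex_orthonormal (g ` F)"
proof -
  have F: "g e \<bullet> g f = (if e = f then 1 else 0)" "g e \<bullet> J (g f) = 0" if "e \<in> F" "f \<in> F" for e f
  proof -
    have "herm e f = (if e = f then 1 else 0)" "type10 e" "type10 f"
      using assms(1) that by (auto simp: unitary_frame_def)
    with herm_type10[of e f]
    have *: "complex_of_real (2 * (fst e \<bullet> fst f)) + \<i> * complex_of_real (2 * (fst e \<bullet> J (fst f)))
        = (if e = f then 1 else 0)" by simp
    show "g e \<bullet> g f = (if e = f then 1 else 0)"
      using arg_cong[OF *, of Re] by (auto simp: g_def simp flip: mult.assoc)
    show "g e \<bullet> J (g f) = 0"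
      using arg_cong[OF *, of Im] by (auto simp: g_def J_simps split: if_splits)
  qed
  show inj: "inj_on g F"
  proof (rule inj_onI)
    fix e f assume ef: "e \<in> F" "f \<in> F" "g e = g f"
    then show "e = f" using F(1)[of e f] F(1)[of e e] by (auto split: if_splits)
  qed
  have "finite F" using assms(1) by (simp add: unitary_frame_def)
  then show "complex_orthonormal (g ` F)"
    using F inj by (auto simp: complex_orthonormal_def inj_on_eq_iff)
qed

subsection \<open>The mixed curvature\<close>

text \<open>For X = x - iJx the form part gives R(X, conj X) = 2i R(x, Jx). With A = R(x, Jx), which
  is skew and commutes with J, pairing AY with conj Y gives -2i times the inner product of JAu and
  u, where Y = u - iJu; the product of the factors is 4.\<close>

lemma RmC_type10:
  assumes D: "chern_connection D" and m: "m \<in> M" and "type10 X" "type10 Y"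
  shows "RmC D m X (conj_vec X) Y (conj_vec Y)
    = complex_of_real (4 * (J (curv (fst X) (J (fst X)) (fst Y)) \<bullet> fst Y))"
proof -
  obtain x u where X: "X = (x, - J x)" and Y: "Y = (u, - J u)"
    using assms(3,4) by (metis prod.collapse type10_iff)
  have 1: "curv (J x) x z = - curv x (J x) z" for z by (rule curv_antisym)
  have 2: "curv x (J x) u \<bullet> u = 0" using curv_skew[of x "J x" u u] by (simp add: inner_commute)
  have 3: "curv x (J x) u \<bullet> J u = - (J (curv x (J x) u) \<bullet> u)" by (simp add: J_inner_left)
  show ?thesis
    by (simp add: X Y RmC_def cext_def conj_vec_def Rm_eq[OF D m] curv_simps curv_self curv_J 1 2 3
        J_isometry algebra_simps)
qed

lemma hol_sect_eq:
  assumes "chern_connection D" "m \<in> M" "type10 X" "herm X X = 1"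
  shows "hol_sect D m X = complex_of_real (4 * hol (fst X))"
  using RmC_type10[OF assms(1-3,3)] assms(4) by (simp add: hol_sect_def hol_def)

lemma ric_eq:
  assumes D: "chern_connection D" and m: "m \<in> M" and X: "type10 X"
  shows "ric D m X = complex_of_real (tr (\<lambda>z. J (curv (fst X) (J (fst X)) z)))"
proof -
  let ?f = "\<lambda>z. J (curv (fst X) (J (fst X)) z)"
  define F where "F = (SOME F. unitary_frame F)"
  define g :: "'a \<times> 'a \<Rightarrow> 'a" where "g = (\<lambda>e. sqrt 2 *\<^sub>R fst e)"
  have F: "unitary_frame F"
    unfolding F_def using unitary_frame_exists by (rule someI_ex)
  note U = unitary_frame_complex_orthonormal[OF F, folded g_def]
  have "linear ?f" using linear_compose[OF linear_curv linear_J] by (simp add: o_def)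
  moreover have "2 * card (g ` F) = DIM('a)"
    using F by (simp add: card_image[OF U(1)] unitary_frame_def)
  ultimately have "tr ?f = 2 * (\<Sum>u\<in>g ` F. ?f u \<bullet> u)"
    using U(2) by (intro tr_complex_orthonormal) (simp_all add: curv_J)
  also have "\<dots> = 2 * (\<Sum>e\<in>F. ?f (g e) \<bullet> g e)"
    by (simp only: sum.reindex[OF U(1)] o_def)
  also have "\<dots> = (\<Sum>e\<in>F. 4 * (?f (fst e) \<bullet> fst e))"
    by (simp add: g_def curv_simps J_simps sum_distrib_left flip: mult.assoc)
  finally have "complex_of_real (tr ?f) = (\<Sum>e\<in>F. complex_of_real (4 * (?f (fst e) \<bullet> fst e)))"
    by simp
  also have "\<dots> = ric D m X"
    unfolding ric_def F_def[symmetric]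
    using RmC_type10[OF D m X] F by (intro sum.cong) (simp_all add: unitary_frame_def)
  finally show ?thesis by simp
qed

section \<open>The ideal and its filtration\<close>

lemma sum_J_subspace:
  assumes "subspace S"
  shows "subspace {x + J y | x y. x \<in> S \<and> y \<in> S}"
  unfolding subspace_def
proof (intro conjI ballI allI)
  show "0 \<in> {x + J y | x y. x \<in> S \<and> y \<in> S}"
    using subspace_0[OF assms] by (auto intro!: exI[of _ 0] simp: J_simps)
next
  fix v w assume "v \<in> {x + J y | x y. x \<in> S \<and> y \<in> S}" "w \<in> {x + J y | x y. x \<in> S \<and> y \<in> S}"
  then obtain x y x' y' where
    "v + w = (x + x') + J (y + y')" "x \<in> S" "y \<in> S" "x' \<in> S" "y' \<in> S"
    by (auto simp: J_simps algebra_simps)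
  then show "v + w \<in> {x + J y | x y. x \<in> S \<and> y \<in> S}"
    using subspace_add[OF assms] by blast
next
  fix c v assume "v \<in> {x + J y | x y. x \<in> S \<and> y \<in> S}"
  then obtain x y where "c *\<^sub>R v = c *\<^sub>R x + J (c *\<^sub>R y)" "x \<in> S" "y \<in> S"
    by (auto simp: J_simps scaleR_add_right)
  then show "c *\<^sub>R v \<in> {x + J y | x y. x \<in> S \<and> y \<in> S}"
    using subspace_scale[OF assms] by blast
qed

abbreviation derived_J :: "'a set" where
  "derived_J \<equiv> {x + J y | x y. x \<in> derived_algebra \<and> y \<in> derived_algebra}"

lemma nilpotent_hermitian:
  assumes "lower_central derived_J k = {0}"
  shows "nilpotent_hermitian_lie_algebra bracket J derived_J
    (\<lambda>k. {x + J y | x y. x \<in> lower_central derived_J k \<and> y \<in> lower_central derived_J k}) k"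
proof
  have der: "subspace derived_algebra" by (simp add: derived_algebra_def bracket_span_def)
  show I: "subspace derived_J" by (rule sum_J_subspace[OF der])
  have low: "subspace (lower_central derived_J j)" for j
    using I by (cases j) (simp_all add: bracket_span_def)
  show J: "J x \<in> derived_J" if "x \<in> derived_J" for x
  proof -
    from that obtain u v where "J x = - v + J u" "u \<in> derived_algebra" "v \<in> derived_algebra"
      by (auto simp: J_simps J_J)
    then show ?thesis using subspace_neg[OF der] by blast
  qed
  show "bracket x y \<in> derived_J" for x y
  proof -
    have "bracket x y \<in> derived_algebra"
      unfolding derived_algebra_def bracket_span_def by (intro span_base) blast
    moreover have "bracket x y = bracket x y + J 0" by (simp add: J_simps)
    ultimately show ?thesis using subspace_0[OF der] by blast
  qed
  show "{x + J y | x y. x \<in> lower_central derived_J 0 \<and> y \<in> lower_central derived_J 0} = derived_J"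
  proof
    show "{x + J y | x y. x \<in> lower_central derived_J 0 \<and> y \<in> lower_central derived_J 0} \<subseteq> derived_J"
    proof
      fix v assume "v \<in> {x + J y | x y. x \<in> lower_central derived_J 0 \<and> y \<in> lower_central derived_J 0}"
      then obtain x y where "v = x + J y" "x \<in> derived_J" "y \<in> derived_J"
        unfolding lower_central.simps by blast
      then show "v \<in> derived_J" by (simp only: subspace_add[OF I _ J])
    qed
    show "derived_J \<subseteq> {x + J y | x y. x \<in> lower_central derived_J 0 \<and> y \<in> lower_central derived_J 0}"
    proof
      fix x assume "x \<in> derived_J"
      moreover have "x = x + J 0" by (simp add: J_simps)
      ultimately show "x \<in> {x + J y | x y. x \<in> lower_central derived_J 0 \<and> y \<in> lower_central derived_J 0}"
        using subspace_0[OF I] unfolding lower_central.simps by blast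
    qed
  qed
  show "subspace {x + J y | x y. x \<in> lower_central derived_J j \<and> y \<in> lower_central derived_J j}" for j
    by (rule sum_J_subspace[OF low])
  show "B y z \<in> {x + J y | x y. x \<in> lower_central derived_J (Suc j) \<and> y \<in> lower_central derived_J (Suc j)}"
    if y: "y \<in> derived_J"
      and z: "z \<in> {x + J y | x y. x \<in> lower_central derived_J j \<and> y \<in> lower_central derived_J j}"
    for y z j
  proof -
    obtain u v where uv: "z = u + J v" "u \<in> lower_central derived_J j" "v \<in> lower_central derived_J j"
      using z by blast
    have br: "bracket s t \<in> lower_central derived_J (Suc j)"
      if "s \<in> derived_J" "t \<in> lower_central derived_J j" for s t
      unfolding lower_central.simps bracket_span_def using that by (intro span_base) blast
    \<comment> \<open>Complex linearity in the second argument pulls J off \<open>v\<close>. Since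
      \<open>derived_J\<close> is invariant under J, every bracket that remains is one step further
      down the lower central series.\<close>
    have "B y z = (bracket y u - bracket (J y) v) + J (bracket (J y) u + bracket y v)"
      unfolding uv(1) B_simps B_J_right by (simp add: B_def J_simps J_J)
    moreover have "bracket y u - bracket (J y) v \<in> lower_central derived_J (Suc j)"
      using y J uv by (intro subspace_diff[OF low] br)
    moreover have "bracket (J y) u + bracket y v \<in> lower_central derived_J (Suc j)"
      using y J uv by (intro subspace_add[OF low] br)
    ultimately show ?thesis by blast
  qed
  show "{x + J y | x y. x \<in> lower_central derived_J k \<and> y \<in> lower_central derived_J k} = {0}"
    by (auto simp: assms J_simps)
qed

section \<open>Constant mixed curvature\<close>

lemma hol_scaleR: "hol (t *\<^sub>R x) = t ^ 4 * hol x"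
  by (simp add: hol_def curv_simps J_simps power4_eq_xxxx)

lemma mixed_curvature_constant:
  assumes D: "chern_connection D" and ab: "(\<alpha>, \<beta>) \<noteq> (0, 0)"
    and nil: "nilpotent_subalgebra derived_J"
    and eq: "mixed_curvature_eq D \<alpha> \<beta> c"
  shows "c = 0" and "\<beta> \<noteq> 0 \<Longrightarrow> chern_flat D"
proof -
  obtain k where "lower_central derived_J k = {0}"
    using nil by (auto simp: nilpotent_subalgebra_def)
  then interpret nilpotent_hermitian_lie_algebra bracket J derived_J
    "\<lambda>k. {x + J y | x y. x \<in> lower_central derived_J k \<and> y \<in> lower_central derived_J k}" k
    by (rule nilpotent_hermitian)
  define m where "m = \<Gamma> #> \<one>"
  have m: "m \<in> M" unfolding m_def by (rule coset_in_M)
  \<comment> \<open>X = x - iJx is a unit vector exactly when |x|^2 = 1/2. The Ricci term vanishes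
    by \<open>tr_J_curv_eq_0\<close>.\<close>
  have unit: "4 * \<beta> * hol x = c" if "x \<bullet> x = 1 / 2" for x
  proof -
    let ?X = "(x, - J x)"
    have X: "type10 ?X" by (simp add: type10_iff)
    moreover have "herm ?X ?X = 1" by (simp add: herm_type10[OF X X] that)
    ultimately have "mixed_curvature D \<alpha> \<beta> m ?X = complex_of_real c"
      using eq m unfolding mixed_curvature_eq_def by blast
    then have "complex_of_real (4 * \<beta> * hol x) = complex_of_real c"
      using ric_eq[OF D m X] hol_sect_eq[OF D m X \<open>herm ?X ?X = 1\<close>]
      by (simp add: mixed_curvature_def tr_J_curv_eq_0 algebra_simps)
    then show ?thesis using of_real_eq_iff by blast
  qed
  obtain b :: 'a where "b \<in> Basis" using nonempty_Basis by blast
  then have b: "((1 / sqrt 2) *\<^sub>R b) \<bullet> ((1 / sqrt 2) *\<^sub>R b) = 1 / 2" by simp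
  have "hol x = c / \<beta> * (x \<bullet> x)\<^sup>2" if "\<beta> \<noteq> 0" for x
  proof (cases "x = 0")
    case True
    then show ?thesis using hol_scaleR[of 0 x] by simp
  next
    case False
    \<comment> \<open>Dividing by \<open>t\<close> brings \<open>x\<close> to squared length 1/2;
      \<open>hol\<close> is homogeneous of degree 4.\<close>
    define t where "t = sqrt 2 * norm x"
    have t: "t \<noteq> 0" "t\<^sup>2 = 2 * (x \<bullet> x)"
      using False by (simp_all add: t_def power_mult_distrib power2_norm_eq_inner)
    then have "((1 / t) *\<^sub>R x) \<bullet> ((1 / t) *\<^sub>R x) = 1 / 2"
      using False by (simp add: field_simps power2_eq_square)
    from unit[OF this] have "hol x = t ^ 4 * (c / (4 * \<beta>))"
      using t(1) that by (simp add: hol_scaleR field_simps)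
    also have "t ^ 4 = 4 * (x \<bullet> x)\<^sup>2"
      using t(2) by (simp add: power4_eq_xxxx power2_eq_square)
    finally show ?thesis by simp
  qed
  note hol_eq_c = this
  show "c = 0"
  proof (cases "\<beta> = 0")
    case True
    \<comment> \<open>The left side of \<open>unit\<close> is zero here; \<open>b\<close> provides a
      vector to which it applies.\<close>
    then show ?thesis using unit[OF b] by simp
  next
    case False
    then show ?thesis using hol_constant_eq_0[OF hol_eq_c[OF False]] by simp
  qed
  then show "chern_flat D" if "\<beta> \<noteq> 0"
    using hol_eq_0_imp_flat hol_eq_c[OF that] by (simp add: chern_flat_def Rm_eq[OF D])
qed

end

theorem theorem2:
  fixes G :: "'g::{t2_space, second_countable_topology} monoid"
    and A :: "('g, 'a::euclidean_space) chart set"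
    and E :: "'a \<Rightarrow> ('g \<Rightarrow> real) \<Rightarrow> 'g \<Rightarrow> real"
    and \<Gamma> :: "'g set" and J :: "'a \<Rightarrow> 'a"
    and D :: "('g, 'a) covariant_derivative"
    and n :: nat and \<alpha> \<beta> :: real
  assumes "lie_hermitian G A E \<Gamma> J"
    and "DIM('a) = 2 * n"
    and "simply_connected (UNIV :: 'g set)"
    and "lie_hermitian.chern_connection G A E \<Gamma> J D"
    and "(\<alpha>, \<beta>) \<noteq> (0, 0)"
    and "lie_group_algebra.nilpotent_subalgebra E
           {x + J y | x y. x \<in> lie_group_algebra.derived_algebra E \<and>
                           y \<in> lie_group_algebra.derived_algebra E}"
  shows "(\<forall>c::real. lie_hermitian.mixed_curvature_eq G E \<Gamma> J D \<alpha> \<beta> c \<longrightarrow> c = 0) \<and>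
         (lie_hermitian.mixed_curvature_eq G E \<Gamma> J D \<alpha> \<beta> 0 \<and> \<beta> \<noteq> 0 \<longrightarrow>
            lie_hermitian.chern_flat G E \<Gamma> D)"
proof -
  interpret lie_hermitian G A E \<Gamma> J by fact
  show ?thesis
    using mixed_curvature_constant[OF assms(4-6)] by blast
qed

end
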